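(* Let $D\in(0,\infty]$ and let $a,b$ be Borel measurable on $[0,D]$ with $a>0$ on $(0,D)$ and with $b/a$ and $e^{C}/a$ locally integrable on $[0,D]$, where $C(x)=\int_0^x \frac{b(u)}{a(u)}\,du$. Let $\lambda_0$ be the mixed (Dirichlet at $0$, Neumann at $D$) eigenvalue, and let $\varphi$, $\delta$, $\delta_1$, $\delta_1'$ be as defined in the context. Then $$\delta^{-1}\ge{\delta_1'}^{-1}\ge\lambda_0\ge\delta_1^{-1}\ge(4\delta)^{-1},$$ where $$\delta_1=\sup_{x\in(0,D)}\frac1{\sqrt{\varphi(x)}}\int_0^D\varphi(x\wedge\cdot)\sqrt\varphi\,d\mu=\sup_{x\in(0,D)}\bigg(\frac1{\sqrt{\varphi(x)}}\int_0^x\varphi^{3/2}\,d\mu+\sqrt{\varphi(x)}\int_x^D\sqrt\varphi\,d\mu\bigg),$$ $$\delta_1'=\sup_{x\in(0,D)}\frac1{\varphi(x)}\int_0^D\varphi(\cdot\wedge x)^2\,d\mu\in[\delta,2\delta].$$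
   Context: When $D=\infty$, $[0,D]$ is read as $[0,\infty)$ and $\mathcal C[0,D]$ as $\mathcal C[0,\infty)$. Convention $1/\infty=0$. $\mu(dx)=\frac{e^{C(x)}}{a(x)}dx$, $\nu(dx)=e^{-C(x)}dx$, $\mu(\alpha,\beta)=\int_\alpha^\beta d\mu$, $\nu(\alpha,\beta)=\int_\alpha^\beta d\nu$, $\mu(f)=\int_0^D f\,d\mu$, $D(f)=\int_0^D a\,f'^2\,d\mu$ (the functional $D(\cdot)$ is distinct from the endpoint $D$). $$\lambda_0=\inf\Big\{\frac{D(f)}{\mu(f^2)}: f\in\mathcal C^1(0,D)\cap\mathcal C[0,D],\ D(f)<\infty,\ f(0)=0,\ f\ne0\Big\}$$ ($\mu(f^2)=\infty$ is allowed). Set $\varphi(x)=\nu(0,x)$, $\delta=\sup_{x\in(0,D)}\nu(0,x)\,\mu(x,D)$, and $$II(f)(x)=\frac1{f(x)}\int_0^x\nu(ds)\int_s^D f\,d\mu .$$ $\delta_1=\sup_{x\in(0,D)}II(\sqrt\varphi)(x)$ and $\delta_1'=\sup_{x_0\in(0,D)}\inf_{x\in(0,D)}II(\varphi(\cdot\wedge x_0))(x)$. *)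

theory Defs
  imports "HOL-Analysis.Analysis"
begin

text \<open>
  The right endpoint \<open>D\<close> is an extended real, so that \<^term>\<open>einterval 0 D\<close> is the open interval
  \<open>(0,D)\<close>, and the set below is \<open>[0,D]\<close> for finite \<open>D\<close> and \<open>[0,\<infinity>)\<close> for \<open>D = \<infinity>\<close>.
  All coefficients and test functions are total functions on the reals of which only the values
  on \<open>[0,D]\<close> matter. Quantities that may be infinite take values in \<^typ>\<open>ennreal\<close>, where
  \<open>1/\<infinity> = 0\<close>.
\<close>

definition closed_ivl :: "ereal \<Rightarrow> real set" where
  "closed_ivl D = {x. 0 \<le> x \<and> ereal x \<le> D}"

definition locally_integrable_on :: "(real \<Rightarrow> real) \<Rightarrow> real set \<Rightarrow> bool" where
  "locally_integrable_on f S \<longleftrightarrow> (\<forall>K. compact K \<and> K \<subseteq> S \<longrightarrow> set_integrable lborel K f)"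

definition Cfun :: "(real \<Rightarrow> real) \<Rightarrow> (real \<Rightarrow> real) \<Rightarrow> real \<Rightarrow> real" where
  "Cfun a b x = (LINT u:{0..x}|lborel. b u / a u)"

definition mu :: "(real \<Rightarrow> real) \<Rightarrow> (real \<Rightarrow> real) \<Rightarrow> ereal \<Rightarrow> real measure" where
  "mu a b D = density (restrict_space lborel (einterval 0 D))
                (\<lambda>x. ennreal (exp (Cfun a b x) / a x))"

definition nu :: "(real \<Rightarrow> real) \<Rightarrow> (real \<Rightarrow> real) \<Rightarrow> ereal \<Rightarrow> real measure" where
  "nu a b D = density (restrict_space lborel (einterval 0 D))
                (\<lambda>x. ennreal (exp (- Cfun a b x)))"

definition energy :: "(real \<Rightarrow> real) \<Rightarrow> (real \<Rightarrow> real) \<Rightarrow> ereal \<Rightarrow> (real \<Rightarrow> real) \<Rightarrow> ennreal" where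
  "energy a b D f = (\<integral>\<^sup>+ x. ennreal (a x * (deriv f x)\<^sup>2) \<partial>mu a b D)"

definition lambda0 :: "(real \<Rightarrow> real) \<Rightarrow> (real \<Rightarrow> real) \<Rightarrow> ereal \<Rightarrow> ennreal" where
  "lambda0 a b D =
     Inf {energy a b D f / (\<integral>\<^sup>+ x. ennreal ((f x)\<^sup>2) \<partial>mu a b D) | f.
            f C1_differentiable_on einterval 0 D \<and> continuous_on (closed_ivl D) f \<and>
            energy a b D f < \<infinity> \<and> f 0 = 0 \<and> (\<exists>x\<in>closed_ivl D. f x \<noteq> 0)}"

text \<open>
  Under the standing assumptions \<open>C\<close> is continuous on \<open>[0,D]\<close>, so \<open>\<nu>(0,x)\<close> is finite for every
  real \<open>x\<close> in \<open>[0,D]\<close>; hence \<open>\<phi>\<close> is real-valued.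
\<close>

definition phi :: "(real \<Rightarrow> real) \<Rightarrow> (real \<Rightarrow> real) \<Rightarrow> ereal \<Rightarrow> real \<Rightarrow> real" where
  "phi a b D x = measure (nu a b D) (einterval 0 x)"

definition delta :: "(real \<Rightarrow> real) \<Rightarrow> (real \<Rightarrow> real) \<Rightarrow> ereal \<Rightarrow> ennreal" where
  "delta a b D = (SUP x\<in>einterval 0 D.
     emeasure (nu a b D) (einterval 0 x) * emeasure (mu a b D) (einterval x D))"

text \<open>The operator \<open>II\<close> is only applied to functions that are positive on \<open>(0,D)\<close>.\<close>

definition II :: "(real \<Rightarrow> real) \<Rightarrow> (real \<Rightarrow> real) \<Rightarrow> ereal \<Rightarrow> (real \<Rightarrow> real) \<Rightarrow> real \<Rightarrow> ennreal" where
  "II a b D f x =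
     (\<integral>\<^sup>+ s\<in>einterval 0 x. (\<integral>\<^sup>+ y\<in>einterval s D. ennreal (f y) \<partial>mu a b D) \<partial>nu a b D)
       / ennreal (f x)"

definition delta1 :: "(real \<Rightarrow> real) \<Rightarrow> (real \<Rightarrow> real) \<Rightarrow> ereal \<Rightarrow> ennreal" where
  "delta1 a b D = (SUP x\<in>einterval 0 D. II a b D (\<lambda>y. sqrt (phi a b D y)) x)"

definition delta1' :: "(real \<Rightarrow> real) \<Rightarrow> (real \<Rightarrow> real) \<Rightarrow> ereal \<Rightarrow> ennreal" where
  "delta1' a b D =
     (SUP x0\<in>einterval 0 D. INF x\<in>einterval 0 D. II a b D (\<lambda>y. phi a b D (min y x0)) x)"

end

theory Submission
  imports Defs
begin

text \<open>
  All the constants are governed by the tail function \<open>\<mu>(s,D)\<close> and by the scale function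
  \<open>\<phi>(x) = \<nu>(0,x)\<close>, which satisfies \<open>\<phi>' = e\<^bsup>-C\<^esup>\<close>.

  The explicit formulas for \<open>\<delta>\<^sub>1\<close> and \<open>\<delta>\<^sub>1'\<close> come from Tonelli's theorem on the triangle \<open>s < y\<close>
  (\<open>tonelli_triangle\<close>), which turns \<open>\<integral>\<^sub>0\<^sup>x \<nu>(ds) \<integral>\<^sub>s\<^sup>D f d\<mu>\<close> into
  \<open>\<integral> f \<phi>(x \<and> \<cdot>) d\<mu>\<close>. For the truncated function \<open>f = \<phi>(\<cdot> \<and> t)\<close> the resulting quotient
  \<open>II(f)(x)\<close> is smallest at \<open>x = t\<close>, because \<open>\<phi>(y \<and> x)/\<phi>(x \<and> t)\<close> is minimal there for every \<open>y\<close>;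
  so the infimum in \<open>\<delta>\<^sub>1'\<close> can be evaluated.

  The upper bounds in terms of \<open>\<delta>\<close> use only \<open>\<mu>(s,D) \<le> \<delta>/\<phi>(s)\<close>. Writing \<open>\<phi>\<^sup>2\<close> and \<open>\<surd>\<phi>\<close> as
  integrals of their derivatives with respect to \<open>\<nu>\<close> and exchanging the integrals gives
  \<open>\<integral> \<phi>(\<cdot> \<and> x)\<^sup>2 d\<mu> \<le> 2\<delta>\<phi>(x)\<close>, and \<open>\<integral>\<^sub>s\<^sup>D \<surd>\<phi> d\<mu> \<le> 2\<delta>/\<surd>\<phi>(s)\<close>; a further
  integration of the latter gives \<open>\<delta>\<^sub>1 \<le> 4\<delta>\<close>. Restricting \<open>\<integral> \<phi>(\<cdot> \<and> x)\<^sup>2 d\<mu>\<close> to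
  \<open>(x,D)\<close> gives \<open>\<delta> \<le> \<delta>\<^sub>1'\<close>.

  The lower bound \<open>\<lambda>\<^sub>0 \<ge> 1/\<delta>\<^sub>1\<close> is a Hardy inequality (\<open>hardy_inequality\<close>). With
  \<open>G(s) = \<integral>\<^sub>s\<^sup>D \<surd>\<phi> d\<mu>\<close> and \<open>p = e\<^sup>C |f'|\<close>, Cauchy--Schwarz yields
  \<open>f(x)\<^sup>2 \<le> \<integral>\<^sub>0\<^sup>x p\<^sup>2/G d\<nu> \<cdot> \<integral>\<^sub>0\<^sup>x G d\<nu>\<close>; the second factor is at most
  \<open>\<delta>\<^sub>1 \<surd>\<phi>(x)\<close>, and on integrating against \<open>\<mu>\<close> Tonelli's theorem reproduces exactly the weight
  \<open>G\<close>, which cancels and leaves \<open>\<mu>(f\<^sup>2) \<le> \<delta>\<^sub>1 D(f)\<close>. Only finite \<open>\<delta>\<^sub>1\<close> needs an argument, and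
  then \<open>G\<close> is finite on \<open>(0,D)\<close>.

  The upper bound \<open>\<lambda>\<^sub>0 \<le> 1/\<delta>\<^sub>1'\<close> uses the test function \<open>\<phi>(\<cdot> \<and> t)\<close>, whose energy is
  \<open>\<phi>(t)\<close>. It has a corner at \<open>t\<close>, so its derivative is cut off continuously on \<open>[t,y]\<close>
  (\<open>cutoff_test_function\<close>): this only enlarges the function and raises the energy to at most
  \<open>\<phi>(y)\<close>, and letting \<open>y\<close> decrease to \<open>t\<close> gives the bound.
\<close>

section \<open>Integration and extended arithmetic\<close>

text \<open>
  Monotone convergence along compact subintervals. It allows the fundamental theorem of calculus
  to be applied on \<open>[s,y]\<close> when the integrand is singular at, or the interval extends to, an end point.
\<close>
lemma nn_integral_einterval_le:
  fixes M :: "real measure" and \<alpha> \<beta> :: ereal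
  assumes k[measurable]: "k \<in> borel_measurable M"
    and [measurable]: "\<And>s y :: real. {s<..<y} \<inter> space M \<in> sets M"
    and le: "\<And>s y. \<alpha> < ereal s \<Longrightarrow> s < y \<Longrightarrow> ereal y < \<beta> \<Longrightarrow> (\<integral>\<^sup>+ t\<in>{s<..<y}. k t \<partial>M) \<le> c"
  shows "(\<integral>\<^sup>+ t\<in>einterval \<alpha> \<beta>. k t \<partial>M) \<le> c"
proof (cases "\<alpha> < \<beta>")
  case False
  have "einterval \<alpha> \<beta> = {}"
  proof (rule equals0I)
    fix t assume "t \<in> einterval \<alpha> \<beta>"
    then show False
      using False less_trans[of \<alpha> t \<beta>] by (simp add: einterval_iff)
  qed
  then show ?thesis by simp
next
  case True
  obtain u l :: "nat \<Rightarrow> real" where ul: "einterval \<alpha> \<beta> = (\<Union>i. {l i..u i})" "incseq u" "decseq l"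
      "\<And>i. l i < u i" "\<And>i. \<alpha> < l i" "\<And>i. u i < \<beta>"
      "l \<longlonglongrightarrow> \<alpha>" "u \<longlonglongrightarrow> \<beta>"
    by (rule einterval_Icc_approximation[OF True]) (rule that)
  have meas: "(\<lambda>t. k t * indicator {l i<..<u i} t) \<in> borel_measurable M" for i
  proof -
    have "(\<lambda>t. k t * indicator ({l i<..<u i} \<inter> space M) t) \<in> borel_measurable M"
      using assms(2)[of "l i" "u i"] by measurable
    then show ?thesis
      by (rule measurable_cong[THEN iffD1, rotated]) (auto split: split_indicator)
  qed
  have eq: "k t * indicator (einterval \<alpha> \<beta>) t = (SUP i. k t * indicator {l i<..<u i} t)" for t
  proof (rule antisym)
    show "(SUP i. k t * indicator {l i<..<u i} t) \<le> k t * indicator (einterval \<alpha> \<beta>) t"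
      unfolding ul(1) by (intro SUP_least) (auto split: split_indicator intro: less_imp_le)
    show "k t * indicator (einterval \<alpha> \<beta>) t \<le> (SUP i. k t * indicator {l i<..<u i} t)"
    proof (cases "t \<in> einterval \<alpha> \<beta>")
      case True
      then have "\<alpha> < ereal t" "ereal t < \<beta>" by (auto simp: einterval_def)
      then have "\<forall>\<^sub>F i in sequentially. ereal (l i) < t \<and> t < ereal (u i)"
        using order_tendstoD(2)[OF ul(7)] order_tendstoD(1)[OF ul(8)] eventually_conj by blast
      then obtain i where "l i < t" "t < u i"
        by (auto simp: eventually_sequentially)
      then show ?thesis
        by (intro SUP_upper2[of i]) (auto split: split_indicator)
    qed auto
  qed
  have "(\<integral>\<^sup>+ t\<in>einterval \<alpha> \<beta>. k t \<partial>M) = (SUP i. \<integral>\<^sup>+ t\<in>{l i<..<u i}. k t \<partial>M)"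
    unfolding eq
  proof (rule nn_integral_monotone_convergence_SUP[OF _ meas])
    have "{l i<..<u i} \<subseteq> {l j<..<u j}" if "i \<le> j" for i j
      using incseqD[OF ul(2) that] decseqD[OF ul(3) that] by auto
    then show "incseq (\<lambda>i t. k t * indicator {l i<..<u i} t)"
      by (auto simp: incseq_def le_fun_def intro!: mult_left_mono indicator_leI)
  qed
  also have "\<dots> \<le> c"
    by (intro SUP_least le ul)
  finally show ?thesis .
qed

lemma ereal_less_mono: "x \<le> y \<Longrightarrow> ereal y < D \<Longrightarrow> ereal x < D"
  by (rule le_less_trans[of _ "ereal y"]) auto

lemma ennreal_inverse_antimono:
  fixes x y :: ennreal
  shows "x \<le> y \<Longrightarrow> inverse y \<le> inverse x"
  by (simp add: less_eq_ennreal.rep_eq inverse_ennreal.rep_eq ereal_inverse_antimono)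

lemma ennreal_inverse_inverse [simp]: "inverse (inverse x) = (x :: ennreal)"
  by (cases x; cases "x = 0") (auto simp: inverse_ennreal)

text \<open>Cauchy--Schwarz applied to the factorisation \<open>p = (p/\<surd>g) \<cdot> \<surd>g\<close>.\<close>
lemma Cauchy_Schwarz_weighted:
  fixes p g :: "'a \<Rightarrow> real"
  assumes [measurable]: "p \<in> borel_measurable M" "g \<in> borel_measurable M" "A \<in> sets M"
    and p: "\<And>x. x \<in> space M \<Longrightarrow> 0 \<le> p x" and g: "\<And>x. x \<in> space M \<Longrightarrow> 0 < g x"
  shows "(\<integral>\<^sup>+ x\<in>A. ennreal (p x) \<partial>M)\<^sup>2
    \<le> (\<integral>\<^sup>+ x\<in>A. ennreal ((p x)\<^sup>2 / g x) \<partial>M) * (\<integral>\<^sup>+ x\<in>A. ennreal (g x) \<partial>M)"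
proof -
  let ?u = "\<lambda>x. ennreal (p x / sqrt (g x)) * indicator A x" and ?v = "\<lambda>x. ennreal (sqrt (g x)) * indicator A x"
  have "(\<integral>\<^sup>+ x\<in>A. ennreal (p x) \<partial>M) = (\<integral>\<^sup>+ x. ?u x * ?v x \<partial>M)"
  proof (rule nn_integral_cong)
    fix x assume x: "x \<in> space M"
    then have "ennreal (p x) = ennreal (p x / sqrt (g x)) * ennreal (sqrt (g x))"
      using p[OF x] g[OF x] by (subst ennreal_mult[symmetric]) auto
    then show "ennreal (p x) * indicator A x = ?u x * ?v x"
      by (auto split: split_indicator)
  qed
  moreover have "(\<integral>\<^sup>+ x. (?u x)\<^sup>2 \<partial>M) = (\<integral>\<^sup>+ x\<in>A. ennreal ((p x)\<^sup>2 / g x) \<partial>M)"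
  proof (rule nn_integral_cong)
    fix x assume x: "x \<in> space M"
    then show "(?u x)\<^sup>2 = ennreal ((p x)\<^sup>2 / g x) * indicator A x"
      using p[OF x] g[OF x]
      by (auto simp: ennreal_power power_divide split: split_indicator)
  qed
  moreover have "(\<integral>\<^sup>+ x. (?v x)\<^sup>2 \<partial>M) = (\<integral>\<^sup>+ x\<in>A. ennreal (g x) \<partial>M)"
  proof (rule nn_integral_cong)
    fix x assume x: "x \<in> space M"
    then show "(?v x)\<^sup>2 = ennreal (g x) * indicator A x"
      using g[OF x] by (auto simp: ennreal_power split: split_indicator)
  qed
  ultimately show ?thesis
    using Cauchy_Schwarz_nn_integral[of ?u M ?v] by simp
qed

section \<open>Speed measure and scale function\<close>

text \<open>
  These hypotheses make \<open>C\<close> continuous on \<open>[0,D)\<close>, so that \<open>\<mu>\<close> and \<open>\<nu>\<close> have finite measurable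
  positive densities on \<open>(0,D)\<close>; Tonelli's theorem then holds for them. Both measures live on the
  open interval, which is abbreviated \<open>I\<close>.
\<close>

locale diffusion =
  fixes a b :: "real \<Rightarrow> real" and D :: ereal
  assumes a_meas: "a \<in> borel_measurable (restrict_space borel (closed_ivl D))"
    and a_pos: "\<And>x. x \<in> einterval 0 D \<Longrightarrow> 0 < a x"
    and drift: "locally_integrable_on (\<lambda>x. b x / a x) (closed_ivl D)"
begin

abbreviation "I \<equiv> einterval 0 D"
abbreviation "C \<equiv> Cfun a b"
abbreviation "M \<equiv> mu a b D"
abbreviation "N \<equiv> nu a b D"
abbreviation "\<phi> \<equiv> phi a b D"

lemma continuous_C:
  assumes "ereal y < D"
  shows "continuous_on {0..y} C"
proof -
  have sub: "{0..x} \<subseteq> closed_ivl D" if "x \<le> y" for x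
  proof
    fix t assume "t \<in> {0..x}"
    then have "0 \<le> t" "ereal t < D" using that ereal_less_mono[OF _ assms, of t] by auto
    then show "t \<in> closed_ivl D" by (simp add: closed_ivl_def less_imp_le)
  qed
  have int: "set_integrable lborel {0..x} (\<lambda>x. b x / a x)" if "x \<le> y" for x
    using drift sub[OF that] unfolding locally_integrable_on_def by blast
  have "C x = integral {0..x} (\<lambda>x. b x / a x)" if "x \<le> y" for x
    using set_borel_integral_eq_integral(2)[OF int[OF that]] by (simp add: Cfun_def)
  then show ?thesis
    using indefinite_integral_continuous_1[OF set_borel_integral_eq_integral(1)[OF int[OF order.refl]]]
    by (subst continuous_on_cong[OF refl]) auto
qed

lemma continuous_C_interior: "continuous_on I C"
proof (rule continuous_at_imp_continuous_on, rule ballI)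
  fix x assume "x \<in> I"
  then have x: "0 < x" "ereal x < D" by (auto simp: einterval_def)
  obtain y where y: "x < y" "ereal y < D"
    using ereal_dense2[OF x(2)] by auto
  show "isCont C x"
    using continuous_on_interior[OF continuous_C[OF y(2)]] x y by simp
qed

lemma I_subset: "I \<subseteq> closed_ivl D"
  by (auto simp: einterval_def closed_ivl_def)

lemma restrict_lborel_measurable:
  "measurable (restrict_space lborel I) L = measurable (restrict_space borel I) L"
  by (rule measurable_cong_sets) (auto simp: sets_restrict_space)

lemma mu_density_measurable [measurable]:
  "(\<lambda>x. ennreal (exp (C x) / a x)) \<in> borel_measurable (restrict_space lborel I)"
proof -
  have [measurable]: "C \<in> borel_measurable (restrict_space borel I)"
    by (rule borel_measurable_continuous_on_restrict[OF continuous_C_interior])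
  have [measurable]: "a \<in> borel_measurable (restrict_space borel I)"
    by (rule measurable_restrict_mono[OF a_meas I_subset])
  show ?thesis unfolding restrict_lborel_measurable by measurable
qed

lemma nu_density_measurable [measurable]:
  "(\<lambda>x. ennreal (exp (- C x))) \<in> borel_measurable (restrict_space lborel I)"
proof -
  have [measurable]: "C \<in> borel_measurable (restrict_space borel I)"
    by (rule borel_measurable_continuous_on_restrict[OF continuous_C_interior])
  show ?thesis unfolding restrict_lborel_measurable by measurable
qed

lemma sets_M [measurable_cong]: "sets M = sets (restrict_space borel I)"
  and sets_N [measurable_cong]: "sets N = sets (restrict_space borel I)"
  by (auto simp: mu_def nu_def sets_restrict_space)

lemma space_M [simp]: "space M = I" and space_N [simp]: "space N = I"
  by (auto simp: mu_def nu_def space_restrict_space)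

sublocale MN: pair_sigma_finite M N
proof -
  interpret R: sigma_finite_measure "restrict_space lborel I"
    by (rule sigma_finite_measure_restrict_space[OF sigma_finite_lborel]) simp
  show "pair_sigma_finite M N"
    unfolding pair_sigma_finite_def mu_def nu_def
    by (intro conjI; subst R.sigma_finite_iff_density_finite) measurable
qed

lemma id_measurable [measurable]: "(\<lambda>x. x) \<in> borel_measurable M" "(\<lambda>x. x) \<in> borel_measurable N"
  unfolding measurable_cong_sets[OF sets_M refl] measurable_cong_sets[OF sets_N refl]
  by (auto intro!: measurable_restrict_space1)

lemma einterval_sets [measurable]:
  "x \<in> I \<Longrightarrow> einterval 0 (ereal x) \<in> sets M" "x \<in> I \<Longrightarrow> einterval 0 (ereal x) \<in> sets N"
  "x \<in> I \<Longrightarrow> einterval (ereal x) D \<in> sets M" "x \<in> I \<Longrightarrow> einterval (ereal x) D \<in> sets N"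
  unfolding sets_M sets_N sets_restrict_space_iff
  by (auto simp: sets_restrict_space_iff einterval_def intro: less_trans ereal_less_mono[OF less_imp_le])

lemma nn_integral_M:
  assumes [measurable]: "k \<in> borel_measurable M"
  shows "(\<integral>\<^sup>+ t. k t \<partial>M) = (\<integral>\<^sup>+ t\<in>I. ennreal (exp (C t) / a t) * k t \<partial>lborel)"
proof -
  have "k \<in> borel_measurable (restrict_space lborel I)"
    using assms unfolding restrict_lborel_measurable measurable_cong_sets[OF sets_M refl] .
  then show ?thesis
    unfolding mu_def
    by (subst nn_integral_density[OF mu_density_measurable]) (auto simp: nn_integral_restrict_space)
qed

lemma nn_integral_N:
  assumes [measurable]: "k \<in> borel_measurable N"
  shows "(\<integral>\<^sup>+ t. k t \<partial>N) = (\<integral>\<^sup>+ t\<in>I. ennreal (exp (- C t)) * k t \<partial>lborel)"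
proof -
  have "k \<in> borel_measurable (restrict_space lborel I)"
    using assms unfolding restrict_lborel_measurable measurable_cong_sets[OF sets_N refl] .
  then show ?thesis
    unfolding nu_def
    by (subst nn_integral_density[OF nu_density_measurable]) (auto simp: nn_integral_restrict_space)
qed

text \<open>
  Both sides integrate \<open>g(y) k(s)\<close> over the triangle \<open>0 < s < y < D\<close>. Every exchange of integrals
  below, including those that stand for an integration by parts, is an instance.
\<close>
lemma tonelli_triangle:
  assumes g[measurable]: "g \<in> borel_measurable M" and k[measurable]: "k \<in> borel_measurable N"
  shows "(\<integral>\<^sup>+ y. g y * (\<integral>\<^sup>+ s\<in>einterval 0 y. k s \<partial>N) \<partial>M)
       = (\<integral>\<^sup>+ s. k s * (\<integral>\<^sup>+ y\<in>einterval s D. g y \<partial>M) \<partial>N)"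
proof -
  have "(\<integral>\<^sup>+ y. g y * (\<integral>\<^sup>+ s\<in>einterval 0 y. k s \<partial>N) \<partial>M)
      = (\<integral>\<^sup>+ y. (\<integral>\<^sup>+ s. (if s < y then g y * k s else 0) \<partial>N) \<partial>M)"
  proof (rule nn_integral_cong)
    fix y assume "y \<in> space M"
    then have "y \<in> I" by simp
    have "g y * (\<integral>\<^sup>+ s\<in>einterval 0 y. k s \<partial>N) = (\<integral>\<^sup>+ s. g y * (k s * indicator (einterval 0 y) s) \<partial>N)"
      by (subst nn_integral_cmult) (use \<open>y \<in> I\<close> in measurable)
    also have "\<dots> = (\<integral>\<^sup>+ s. (if s < y then g y * k s else 0) \<partial>N)"
      by (rule nn_integral_cong) (auto simp: einterval_def split: split_indicator)
    finally show "g y * (\<integral>\<^sup>+ s\<in>einterval 0 y. k s \<partial>N) = \<dots>" .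
  qed
  also have "\<dots> = (\<integral>\<^sup>+ s. (\<integral>\<^sup>+ y. (if s < y then g y * k s else 0) \<partial>M) \<partial>N)"
    by (rule MN.Fubini'[symmetric]) measurable
  also have "\<dots> = (\<integral>\<^sup>+ s. k s * (\<integral>\<^sup>+ y\<in>einterval s D. g y \<partial>M) \<partial>N)"
  proof (rule nn_integral_cong)
    fix s assume "s \<in> space N"
    then have "s \<in> I" by simp
    have "k s * (\<integral>\<^sup>+ y\<in>einterval s D. g y \<partial>M) = (\<integral>\<^sup>+ y. k s * (g y * indicator (einterval s D) y) \<partial>M)"
      by (subst nn_integral_cmult) (use \<open>s \<in> I\<close> in measurable)
    also have "\<dots> = (\<integral>\<^sup>+ y. (if s < y then g y * k s else 0) \<partial>M)"
      by (rule nn_integral_cong) (auto simp: einterval_def mult_ac split: split_indicator)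
    finally show "(\<integral>\<^sup>+ y. (if s < y then g y * k s else 0) \<partial>M) = k s * (\<integral>\<^sup>+ y\<in>einterval s D. g y \<partial>M)" ..
  qed
  finally show ?thesis .
qed

text \<open>
  Freezing \<open>C\<close> outside \<open>[0,y]\<close> extends the density of \<open>\<nu>\<close> to a continuous positive function on the
  whole line, so that its antiderivative has a two-sided derivative also at the end points \<open>0\<close> and \<open>y\<close>.
\<close>
lemma positive_antiderivative:
  assumes y: "0 \<le> y" "ereal y < D"
  obtains \<Phi> g :: "real \<Rightarrow> real" where "continuous_on UNIV g" "\<And>t. g t > 0"
    "\<And>t. t \<in> {0..y} \<Longrightarrow> g t = exp (- C t)"
    "\<And>t. (\<Phi> has_real_derivative g t) (at t)" "\<Phi> 0 = 0"
proof -
  define g where "g t = exp (- C (max 0 (min t y)))" for t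
  have cont: "continuous_on UNIV g"
    unfolding g_def
    by (intro continuous_intros continuous_on_compose2[OF continuous_C[OF y(2)]]) (use y in auto)
  obtain F where F: "\<And>t. (F has_vector_derivative g t) (at t)"
    using einterval_antiderivative[of "-\<infinity>" \<infinity> g] cont
    by (auto simp: continuous_on_eq_continuous_at)
  show thesis
    by (rule that[of g "\<lambda>t. F t - F 0"])
       (use F cont in \<open>auto simp: g_def has_real_derivative_iff_has_vector_derivative
           intro!: derivative_eq_intros\<close>)
qed

lemma nn_integral_N_einterval:
  assumes k[measurable]: "k \<in> borel_measurable N" and y: "0 \<le> s" "ereal y < D"
  shows "(\<integral>\<^sup>+ t\<in>einterval s y. k t \<partial>N) = (\<integral>\<^sup>+ t\<in>{s..y}. ennreal (exp (- C t)) * k t \<partial>lborel)"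
proof -
  have sub: "einterval s y \<subseteq> I"
    using y ereal_less_mono[OF less_imp_le y(2)] by (auto simp: einterval_def)
  have [measurable]: "einterval (ereal s) (ereal y) \<in> sets N"
    using sub by (simp add: sets_N sets_restrict_space_iff)
  have "(\<integral>\<^sup>+ t\<in>einterval s y. k t \<partial>N) = (\<integral>\<^sup>+ t\<in>I. ennreal (exp (- C t)) * (k t * indicator (einterval s y) t) \<partial>lborel)"
    by (rule nn_integral_N) measurable
  also have "\<dots> = (\<integral>\<^sup>+ t\<in>{s..y}. ennreal (exp (- C t)) * k t \<partial>lborel)"
  proof (rule nn_integral_cong_AE)
    have "AE t in lborel. t \<noteq> s \<and> t \<noteq> y"
      using AE_lborel_singleton[of s] AE_lborel_singleton[of y] by eventually_elim auto
    then show "AE t in lborel. ennreal (exp (- C t)) * (k t * indicator (einterval s y) t) * indicator I t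
        = ennreal (exp (- C t)) * k t * indicator {s..y} t"
      by eventually_elim (use sub in \<open>auto simp: einterval_eq_Icc einterval_def split: split_indicator\<close>)
  qed
  finally show ?thesis .
qed

lemma emeasure_N_antiderivative:
  assumes y: "0 \<le> y" "ereal y < D"
    and g: "continuous_on UNIV g" "\<And>t. g t > 0" "\<And>t. t \<in> {0..y} \<Longrightarrow> g t = exp (- C t)"
    and \<Phi>: "\<And>t. (\<Phi> has_real_derivative g t) (at t)" "\<Phi> 0 = 0"
    and x: "x \<in> {0..y}"
  shows "emeasure N (einterval 0 x) = ennreal (\<Phi> x)" "\<phi> x = \<Phi> x"
proof -
  have [measurable]: "g \<in> borel_measurable borel"
    by (rule borel_measurable_continuous_onI[OF g(1)])
  have xD: "ereal x < D" using x y by (auto intro: ereal_less_mono)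
  have [measurable]: "einterval 0 (ereal x) \<in> sets N"
    using ereal_less_mono[OF less_imp_le xD] by (auto simp: sets_N sets_restrict_space_iff einterval_def)
  have "emeasure N (einterval 0 x) = (\<integral>\<^sup>+ t\<in>einterval 0 x. 1 \<partial>N)"
    by simp
  also have "\<dots> = (\<integral>\<^sup>+ t\<in>{0..x}. ennreal (exp (- C t)) * 1 \<partial>lborel)"
    using nn_integral_N_einterval[of "\<lambda>_. 1" 0 x] xD by (simp add: zero_ereal_def)
  also have "\<dots> = (\<integral>\<^sup>+ t. ennreal (g t) * indicator {0..x} t \<partial>lborel)"
    by (rule nn_integral_cong) (use x in \<open>auto simp: g(3) split: split_indicator\<close>)
  also have "\<dots> = ennreal (\<Phi> x - \<Phi> 0)"
    by (rule nn_integral_FTC_Icc) (use \<Phi> g(2) x in \<open>auto intro: less_imp_le\<close>)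
  finally show *: "emeasure N (einterval 0 x) = ennreal (\<Phi> x)" using \<Phi> by simp
  have "\<Phi> 0 \<le> \<Phi> x"
    by (rule DERIV_nonneg_imp_nondecreasing) (use x \<Phi>(1) less_imp_le[OF g(2)] in auto)
  then have "\<Phi> x \<ge> 0" using \<Phi>(2) by simp
  then show "\<phi> x = \<Phi> x" using * by (simp add: phi_def measure_def)
qed

text \<open>
  The form in which \<open>\<phi>' = e\<^bsup>-C\<^esup>\<close> is used: on \<open>[0,y]\<close> the scale function agrees with an
  everywhere differentiable \<open>\<Phi>\<close>.
\<close>
lemma phi_extension:
  assumes y: "0 \<le> y" "ereal y < D"
  obtains \<Phi> g :: "real \<Rightarrow> real" where "continuous_on UNIV g" "\<And>t. g t > 0"
    "\<And>t. t \<in> {0..y} \<Longrightarrow> g t = exp (- C t)"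
    "\<And>t. (\<Phi> has_real_derivative g t) (at t)"
    "\<And>t. t \<in> {0..y} \<Longrightarrow> \<phi> t = \<Phi> t"
    "\<And>t. t \<in> {0..y} \<Longrightarrow> emeasure N (einterval 0 t) = ennreal (\<Phi> t)"
proof -
  obtain \<Phi> g where *: "continuous_on UNIV g" "\<And>t. g t > 0" "\<And>t. t \<in> {0..y} \<Longrightarrow> g t = exp (- C t)"
    "\<And>t. (\<Phi> has_real_derivative g t) (at t)" "\<Phi> 0 = 0"
    using positive_antiderivative[OF y] by metis
  show thesis
    by (rule that[of g \<Phi>, OF *(1,2,3,4)]) (use *(3) in \<open>auto intro!: emeasure_N_antiderivative[OF y *(1,2) _ *(4,5)]\<close>)
qed

lemma phi_0 [simp]: "\<phi> 0 = 0"
  by (simp add: phi_def einterval_def not_less_iff_gr_or_eq[symmetric] zero_ereal_def[symmetric] cong: conj_cong)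

lemma emeasure_N:
  assumes "0 \<le> x" "ereal x < D"
  shows "emeasure N (einterval 0 x) = ennreal (\<phi> x)"
proof -
  obtain \<Phi> g where *: "continuous_on UNIV g" "\<And>t. g t > 0"
    "\<And>t. t \<in> {0..x} \<Longrightarrow> g t = exp (- C t)" "\<And>t. (\<Phi> has_real_derivative g t) (at t)"
    and eq: "\<And>t. t \<in> {0..x} \<Longrightarrow> \<phi> t = \<Phi> t"
      "\<And>t. t \<in> {0..x} \<Longrightarrow> emeasure N (einterval 0 t) = ennreal (\<Phi> t)"
    using phi_extension[OF assms] by metis
  show ?thesis using eq[of x] assms by simp
qed

lemma phi_strict_mono:
  assumes "0 \<le> x" "x < y" "ereal y < D"
  shows "\<phi> x < \<phi> y"
proof -
  have y: "0 \<le> y" "ereal y < D" using assms by auto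
  obtain \<Phi> g where *: "continuous_on UNIV g" "\<And>t. g t > 0"
    "\<And>t. t \<in> {0..y} \<Longrightarrow> g t = exp (- C t)" "\<And>t. (\<Phi> has_real_derivative g t) (at t)"
    and eq: "\<And>t. t \<in> {0..y} \<Longrightarrow> \<phi> t = \<Phi> t"
      "\<And>t. t \<in> {0..y} \<Longrightarrow> emeasure N (einterval 0 t) = ennreal (\<Phi> t)"
    using phi_extension[OF y] by metis
  have "\<Phi> x < \<Phi> y" by (rule DERIV_pos_imp_increasing[OF assms(2)]) (use * in blast)
  then show ?thesis using eq(1)[of x] eq(1)[of y] assms by simp
qed

lemma phi_mono: "0 \<le> x \<Longrightarrow> x \<le> y \<Longrightarrow> ereal y < D \<Longrightarrow> \<phi> x \<le> \<phi> y"
  using phi_strict_mono[of x y] by (cases "x = y") auto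

lemma phi_pos: "x \<in> I \<Longrightarrow> 0 < \<phi> x"
  using phi_strict_mono[of 0 x] by (simp add: einterval_def)

lemma phi_nonneg [simp]: "0 \<le> \<phi> x"
  by (simp add: phi_def)

lemma continuous_phi:
  assumes y: "ereal y < D"
  shows "continuous_on {0..y} \<phi>"
proof (cases "0 \<le> y")
  case True
  obtain \<Phi> g where *: "continuous_on UNIV g" "\<And>t. g t > 0"
    "\<And>t. t \<in> {0..y} \<Longrightarrow> g t = exp (- C t)" "\<And>t. (\<Phi> has_real_derivative g t) (at t)"
    and eq: "\<And>t. t \<in> {0..y} \<Longrightarrow> \<phi> t = \<Phi> t"
      "\<And>t. t \<in> {0..y} \<Longrightarrow> emeasure N (einterval 0 t) = ennreal (\<Phi> t)"
    using phi_extension[OF True y] by metis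
  have "continuous_on {0..y} \<Phi>"
    using *(4) by (meson DERIV_isCont continuous_at_imp_continuous_on)
  then show ?thesis
    by (subst continuous_on_cong[OF refl eq(1)]) auto
qed auto

lemma phi_measurable [measurable]: "\<phi> \<in> borel_measurable M" "\<phi> \<in> borel_measurable N"
proof -
  have "mono_on I \<phi>"
    by (auto simp: mono_on_def einterval_def intro!: phi_mono)
  then have "\<phi> \<in> borel_measurable (restrict_space borel I)"
    by (rule borel_measurable_mono_on_fnc)
  then show "\<phi> \<in> borel_measurable M" "\<phi> \<in> borel_measurable N"
    unfolding measurable_cong_sets[OF sets_M refl] measurable_cong_sets[OF sets_N refl] by auto
qed

lemma phi_min_measurable:
  assumes "x \<in> I"
  shows "(\<lambda>y. \<phi> (min y x)) \<in> borel_measurable M"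
proof -
  have "mono_on I (\<lambda>y. \<phi> (min y x))"
    using assms by (auto simp: mono_on_def einterval_def min_def intro!: phi_mono)
  then have "(\<lambda>y. \<phi> (min y x)) \<in> borel_measurable (restrict_space borel I)"
    by (rule borel_measurable_mono_on_fnc)
  then show ?thesis
    unfolding measurable_cong_sets[OF sets_M refl] .
qed

text \<open>
  Change of variables \<open>u = \<phi>(t)\<close>: since \<open>\<nu>\<close> has distribution function \<open>\<phi>\<close>, integrals of functions
  of \<open>\<phi>\<close> reduce to one-variable calculus.
\<close>
lemma nn_integral_comp_phi:
  assumes [measurable]: "h \<in> borel_measurable borel"
    and s: "0 \<le> s" "s \<le> y" "ereal y < D"
    and H: "\<And>u. \<phi> s \<le> u \<Longrightarrow> u \<le> \<phi> y \<Longrightarrow> (H has_real_derivative h u) (at u)"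
    and h: "\<And>u. \<phi> s \<le> u \<Longrightarrow> u \<le> \<phi> y \<Longrightarrow> 0 \<le> h u"
  shows "(\<integral>\<^sup>+ t\<in>einterval s y. ennreal (h (\<phi> t)) \<partial>N) = ennreal (H (\<phi> y) - H (\<phi> s))"
proof -
  have y: "0 \<le> y" "ereal y < D" using s by auto
  obtain \<Phi> g where *: "continuous_on UNIV g" "\<And>t. g t > 0"
    "\<And>t. t \<in> {0..y} \<Longrightarrow> g t = exp (- C t)" "\<And>t. (\<Phi> has_real_derivative g t) (at t)"
    and eq: "\<And>t. t \<in> {0..y} \<Longrightarrow> \<phi> t = \<Phi> t"
      "\<And>t. t \<in> {0..y} \<Longrightarrow> emeasure N (einterval 0 t) = ennreal (\<Phi> t)"
    using phi_extension[OF y] by metis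
  have [measurable]: "g \<in> borel_measurable borel"
    by (rule borel_measurable_continuous_onI[OF *(1)])
  have [measurable]: "\<Phi> \<in> borel_measurable borel"
    using *(4) by (intro borel_measurable_continuous_onI) (meson DERIV_isCont continuous_at_imp_continuous_on)
  have rng: "\<phi> s \<le> \<Phi> t \<and> \<Phi> t \<le> \<phi> y" if "t \<in> {s..y}" for t
    using that s eq(1)[of t] phi_mono[of s t] phi_mono[of t y]
    by (auto intro: ereal_less_mono)
  have "(\<integral>\<^sup>+ t\<in>einterval s y. ennreal (h (\<phi> t)) \<partial>N)
      = (\<integral>\<^sup>+ t\<in>{s..y}. ennreal (exp (- C t)) * ennreal (h (\<phi> t)) \<partial>lborel)"
    by (rule nn_integral_N_einterval) (use s in measurable)
  also have "\<dots> = (\<integral>\<^sup>+ t. ennreal (h (\<Phi> t) * g t) * indicator {s..y} t \<partial>lborel)"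
  proof (rule nn_integral_cong)
    fix t
    show "ennreal (exp (- C t)) * ennreal (h (\<phi> t)) * indicator {s..y} t
        = ennreal (h (\<Phi> t) * g t) * indicator {s..y} t"
    proof (cases "t \<in> {s..y}")
      case True
      then have t: "t \<in> {0..y}" using s by auto
      have "ennreal (h (\<Phi> t) * g t) = ennreal (exp (- C t)) * ennreal (h (\<phi> t))"
        unfolding eq(1)[OF t] *(3)[OF t, symmetric]
        by (subst mult.commute) (rule ennreal_mult'[OF less_imp_le[OF *(2)]])
      then show ?thesis by simp
    qed simp
  qed
  also have "\<dots> = ennreal (H (\<Phi> y) - H (\<Phi> s))"
    by (rule nn_integral_FTC_Icc[where F = "\<lambda>t. H (\<Phi> t)"])
       (use rng *(2) h s in \<open>auto intro!: DERIV_chain2[OF H *(4)] mult_nonneg_nonneg intro: less_imp_le\<close>)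
  finally show ?thesis using eq(1) s by simp
qed

section \<open>The explicit formulas\<close>

lemma emeasure_N_I: "x \<in> I \<Longrightarrow> emeasure N (einterval 0 x) = ennreal (\<phi> x)"
  by (rule emeasure_N) (simp_all add: einterval_def)

lemma nn_integral_primitive_measurable:
  assumes [measurable]: "k \<in> borel_measurable N"
  shows "(\<lambda>y. \<integral>\<^sup>+ s\<in>einterval 0 y. k s \<partial>N) \<in> borel_measurable M"
proof -
  have "(\<lambda>y. \<integral>\<^sup>+ s. (if s < y then k s else 0) \<partial>N) \<in> borel_measurable M"
    by measurable
  then show ?thesis
    by (rule measurable_cong[THEN iffD1, rotated])
       (auto intro!: nn_integral_cong simp: einterval_def split: split_indicator)
qed

text \<open>The inner factor produced by Tonelli's theorem is \<open>\<nu>(0, x \<and> y) = \<phi>(x \<and> y)\<close>.\<close>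
lemma nn_integral_iterated_eq:
  assumes [measurable]: "g \<in> borel_measurable M" and x: "x \<in> I"
  shows "(\<integral>\<^sup>+ s\<in>einterval 0 x. (\<integral>\<^sup>+ y\<in>einterval s D. g y \<partial>M) \<partial>N) = (\<integral>\<^sup>+ y. g y * ennreal (\<phi> (min y x)) \<partial>M)"
proof -
  have "(\<integral>\<^sup>+ s\<in>einterval 0 x. (\<integral>\<^sup>+ y\<in>einterval s D. g y \<partial>M) \<partial>N)
      = (\<integral>\<^sup>+ s. indicator (einterval 0 x) s * (\<integral>\<^sup>+ y\<in>einterval s D. g y \<partial>M) \<partial>N)"
    by (simp add: mult.commute)
  also have "\<dots> = (\<integral>\<^sup>+ y. g y * (\<integral>\<^sup>+ s\<in>einterval 0 y. indicator (einterval 0 x) s \<partial>N) \<partial>M)"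
    by (rule tonelli_triangle[symmetric]) (use x in measurable)
  also have "\<dots> = (\<integral>\<^sup>+ y. g y * ennreal (\<phi> (min y x)) \<partial>M)"
  proof (rule nn_integral_cong)
    fix y assume "y \<in> space M"
    then have min: "min y x \<in> I" using x by (auto simp: min_def)
    have "(\<integral>\<^sup>+ s\<in>einterval 0 y. indicator (einterval 0 x) s \<partial>N)
        = (\<integral>\<^sup>+ s. indicator (einterval 0 (min y x)) s \<partial>N)"
      by (rule nn_integral_cong) (auto simp: einterval_def split: split_indicator)
    also have "\<dots> = ennreal (\<phi> (min y x))"
      using min einterval_sets(2)[OF min] emeasure_N[of "min y x"] by (simp add: einterval_def)
    finally show "g y * (\<integral>\<^sup>+ s\<in>einterval 0 y. indicator (einterval 0 x) s \<partial>N) = g y * ennreal (\<phi> (min y x))"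
      by simp
  qed
  finally show ?thesis .
qed

lemma II_eq:
  assumes "f \<in> borel_measurable M" and x: "x \<in> I"
  shows "II a b D f x = (\<integral>\<^sup>+ y. ennreal (f y) * ennreal (\<phi> (min y x)) \<partial>M) / ennreal (f x)"
proof -
  have "(\<lambda>y. ennreal (f y)) \<in> borel_measurable M"
    using assms(1) by measurable
  then show ?thesis unfolding II_def by (subst nn_integral_iterated_eq[OF _ x]) auto
qed

lemma delta1_eq:
  "delta1 a b D = (SUP t\<in>I. inverse (ennreal (sqrt (\<phi> t))) *
                 (\<integral>\<^sup>+ y. ennreal (\<phi> (min t y) * sqrt (\<phi> y)) \<partial>M))"
  unfolding delta1_def
proof (rule SUP_cong[OF refl])
  fix t assume t: "t \<in> I"
  have "II a b D (\<lambda>y. sqrt (\<phi> y)) t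
      = (\<integral>\<^sup>+ y. ennreal (sqrt (\<phi> y)) * ennreal (\<phi> (min y t)) \<partial>M) / ennreal (sqrt (\<phi> t))"
    by (rule II_eq[OF _ t]) measurable
  then show "II a b D (\<lambda>y. sqrt (\<phi> y)) t = inverse (ennreal (sqrt (\<phi> t))) *
                 (\<integral>\<^sup>+ y. ennreal (\<phi> (min t y) * sqrt (\<phi> y)) \<partial>M)"
    by (simp add: divide_ennreal_def mult.commute min.commute ennreal_mult)
qed

lemma AE_M_neq: "AE y in M. y \<noteq> t"
proof -
  have "AE y in lborel. y \<noteq> t" by (rule AE_lborel_singleton)
  then show ?thesis
    unfolding mu_def by (subst AE_density[OF mu_density_measurable]) (auto simp: AE_restrict_space_iff)
qed

lemma nn_integral_split:
  assumes t: "t \<in> I" and [measurable]: "g \<in> borel_measurable M"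
  shows "(\<integral>\<^sup>+ y. g y \<partial>M) = (\<integral>\<^sup>+ y\<in>einterval 0 t. g y \<partial>M) + (\<integral>\<^sup>+ y\<in>einterval t D. g y \<partial>M)"
proof -
  have [measurable]: "einterval 0 (ereal t) \<in> sets M" "einterval (ereal t) D \<in> sets M"
    using t by (auto intro: einterval_sets)
  have "(\<integral>\<^sup>+ y. g y \<partial>M) = (\<integral>\<^sup>+ y. g y * indicator (einterval 0 t) y + g y * indicator (einterval t D) y \<partial>M)"
    using AE_M_neq[of t] AE_space
    by (intro nn_integral_cong_AE, eventually_elim)
       (auto simp: einterval_def split: split_indicator)
  also have "\<dots> = (\<integral>\<^sup>+ y\<in>einterval 0 t. g y \<partial>M) + (\<integral>\<^sup>+ y\<in>einterval t D. g y \<partial>M)"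
    by (rule nn_integral_add) measurable
  finally show ?thesis .
qed

lemma delta1_eq_split:
  "delta1 a b D = (SUP t\<in>I. inverse (ennreal (sqrt (\<phi> t))) *
                   (\<integral>\<^sup>+ y\<in>einterval 0 t. ennreal (\<phi> y powr (3/2)) \<partial>M) +
                 ennreal (sqrt (\<phi> t)) * (\<integral>\<^sup>+ y\<in>einterval t D. ennreal (sqrt (\<phi> y)) \<partial>M))"
  unfolding delta1_eq
proof (rule SUP_cong[OF refl])
  fix t assume t: "t \<in> I"
  have [measurable]: "einterval 0 (ereal t) \<in> sets M" "einterval (ereal t) D \<in> sets M"
    using t by (auto intro: einterval_sets)
  have pos: "0 < \<phi> t" by (rule phi_pos[OF t])
  let ?g = "\<lambda>y. ennreal (\<phi> (min t y) * sqrt (\<phi> y))"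
  have "(\<lambda>y. \<phi> (min t y)) \<in> borel_measurable M"
    using phi_min_measurable[OF t] by (simp add: min.commute)
  then have [measurable]: "?g \<in> borel_measurable M" by measurable
  have 1: "(\<integral>\<^sup>+ y\<in>einterval 0 t. ?g y \<partial>M) = (\<integral>\<^sup>+ y\<in>einterval 0 t. ennreal (\<phi> y powr (3/2)) \<partial>M)"
  proof (rule nn_integral_cong)
    fix y assume "y \<in> space M"
    then have "0 < \<phi> y" by (simp add: phi_pos)
    then have "\<phi> y powr (3/2) = \<phi> y * sqrt (\<phi> y)"
      using powr_add[of "\<phi> y" 1 "1/2"] by (simp add: powr_half_sqrt)
    then show "?g y * indicator (einterval 0 t) y = ennreal (\<phi> y powr (3/2)) * indicator (einterval 0 t) y"
      by (auto simp: einterval_def split: split_indicator)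
  qed
  have "(\<integral>\<^sup>+ y\<in>einterval t D. ?g y \<partial>M)
      = (\<integral>\<^sup>+ y. ennreal (\<phi> t) * (ennreal (sqrt (\<phi> y)) * indicator (einterval t D) y) \<partial>M)"
    by (rule nn_integral_cong) (auto simp: einterval_def ennreal_mult min_def split: split_indicator)
  also have "\<dots> = ennreal (\<phi> t) * (\<integral>\<^sup>+ y\<in>einterval t D. ennreal (sqrt (\<phi> y)) \<partial>M)"
    by (rule nn_integral_cmult) measurable
  finally have 2: "(\<integral>\<^sup>+ y\<in>einterval t D. ?g y \<partial>M)
      = ennreal (\<phi> t) * (\<integral>\<^sup>+ y\<in>einterval t D. ennreal (sqrt (\<phi> y)) \<partial>M)" .
  have 3: "inverse (ennreal (sqrt (\<phi> t))) * ennreal (\<phi> t) = ennreal (sqrt (\<phi> t))"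
    using pos by (simp add: inverse_ennreal ennreal_mult[symmetric] real_div_sqrt divide_inverse_commute[symmetric])
  show "inverse (ennreal (sqrt (\<phi> t))) * (\<integral>\<^sup>+ y. ?g y \<partial>M)
      = inverse (ennreal (sqrt (\<phi> t))) * (\<integral>\<^sup>+ y\<in>einterval 0 t. ennreal (\<phi> y powr (3/2)) \<partial>M) +
        ennreal (sqrt (\<phi> t)) * (\<integral>\<^sup>+ y\<in>einterval t D. ennreal (sqrt (\<phi> y)) \<partial>M)"
    unfolding nn_integral_split[OF t \<open>?g \<in> borel_measurable M\<close>] 1 2
    by (simp only: distrib_left mult.assoc[symmetric] 3)
qed

text \<open>
  By the iterated-integral formula it suffices that
  \<open>\<phi>(y \<and> t)/\<phi>(t) \<le> \<phi>(y \<and> x)/\<phi>(x \<and> t)\<close> for all \<open>y\<close>. For \<open>x \<ge> t\<close> this is monotonicity of \<open>\<phi>\<close>; for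
  \<open>x \<le> t\<close> it holds because \<open>\<phi>(y \<and> x)/\<phi>(x) = min 1 (\<phi>(y)/\<phi>(x))\<close> decreases in \<open>x\<close>.
\<close>
lemma II_truncated_minimal:
  assumes x: "x \<in> I" and t: "t \<in> I"
  shows "II a b D (\<lambda>y. \<phi> (min y t)) t \<le> II a b D (\<lambda>y. \<phi> (min y t)) x"
proof -
  note [measurable] = phi_min_measurable[OF t] phi_min_measurable[OF x]
  have pos: "0 < \<phi> t" "0 < \<phi> (min x t)" using phi_pos x t by (auto simp: min_def)
  have "(\<integral>\<^sup>+ y. ennreal (\<phi> (min y t)) * ennreal (\<phi> (min y t)) \<partial>M) / ennreal (\<phi> t)
      = (\<integral>\<^sup>+ y. ennreal (\<phi> (min y t)) * ennreal (\<phi> (min y t)) / ennreal (\<phi> t) \<partial>M)"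
    by (rule nn_integral_divide[symmetric]) measurable
  also have "\<dots> \<le> (\<integral>\<^sup>+ y. ennreal (\<phi> (min y t)) * ennreal (\<phi> (min y x)) / ennreal (\<phi> (min x t)) \<partial>M)"
  proof (rule nn_integral_mono)
    fix y assume "y \<in> space M"
    then have y: "0 < y" "ereal y < D" "y \<in> I" by (auto simp: einterval_def)
    have xt: "0 < x" "ereal x < D" "0 < t" "ereal t < D" using x t by (auto simp: einterval_def)
    have "\<phi> (min y t) * \<phi> (min x t) \<le> \<phi> t * \<phi> (min y x)"
    proof (cases "x \<le> t")
      case True
      show ?thesis
      proof (cases "y \<le> x")
        case True
        then have "\<phi> x \<le> \<phi> t" using xt \<open>x \<le> t\<close> by (intro phi_mono) auto
        then show ?thesis using True \<open>x \<le> t\<close> by (simp add: mult_right_mono mult.commute)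
      next
        case False
        have "\<phi> (min y t) \<le> \<phi> t" using xt y by (intro phi_mono) auto
        then show ?thesis using False \<open>x \<le> t\<close> by (simp add: mult_right_mono)
      qed
    next
      case False
      then have "\<phi> (min y t) \<le> \<phi> (min y x)" using xt y by (intro phi_mono) (auto simp: min_def)
      then show ?thesis using False by (simp add: mult_left_mono mult.commute)
    qed
    then have "\<phi> (min y t) / \<phi> t \<le> \<phi> (min y x) / \<phi> (min x t)"
      using pos by (simp add: field_simps)
    then have "\<phi> (min y t) * (\<phi> (min y t) / \<phi> t) \<le> \<phi> (min y t) * (\<phi> (min y x) / \<phi> (min x t))"
      by (rule mult_left_mono) simp
    then show "ennreal (\<phi> (min y t)) * ennreal (\<phi> (min y t)) / ennreal (\<phi> t)
       \<le> ennreal (\<phi> (min y t)) * ennreal (\<phi> (min y x)) / ennreal (\<phi> (min x t))"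
      using pos by (simp add: ennreal_mult[symmetric] divide_ennreal)
  qed
  also have "\<dots> = (\<integral>\<^sup>+ y. ennreal (\<phi> (min y t)) * ennreal (\<phi> (min y x)) \<partial>M) / ennreal (\<phi> (min x t))"
    by (rule nn_integral_divide) measurable
  finally show ?thesis
    using x t by (simp add: II_eq)
qed

text \<open>The infimum over \<open>x\<close> is attained at the truncation point.\<close>
lemma delta1'_eq:
  "delta1' a b D = (SUP t\<in>I. inverse (ennreal (\<phi> t)) * (\<integral>\<^sup>+ y. ennreal ((\<phi> (min y t))\<^sup>2) \<partial>M))"
  unfolding delta1'_def
proof (rule SUP_cong[OF refl])
  fix t assume t: "t \<in> I"
  have "(INF x\<in>I. II a b D (\<lambda>y. \<phi> (min y t)) x) = II a b D (\<lambda>y. \<phi> (min y t)) t"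
    by (intro antisym INF_lower[OF t] INF_greatest II_truncated_minimal t)
  also have "\<dots> = inverse (ennreal (\<phi> t)) * (\<integral>\<^sup>+ y. ennreal ((\<phi> (min y t))\<^sup>2) \<partial>M)"
    using II_eq[OF phi_min_measurable[OF t] t]
    by (simp add: divide_ennreal_def mult.commute ennreal_mult power2_eq_square)
  finally show "(INF x\<in>I. II a b D (\<lambda>y. \<phi> (min y t)) x)
    = inverse (ennreal (\<phi> t)) * (\<integral>\<^sup>+ y. ennreal ((\<phi> (min y t))\<^sup>2) \<partial>M)" .
qed

section \<open>Comparison with the Hardy constant\<close>

lemma delta_upper:
  assumes "x \<in> I"
  shows "emeasure M (einterval x D) * ennreal (\<phi> x) \<le> delta a b D"
  using assms SUP_upper[OF assms, of "\<lambda>x. emeasure N (einterval 0 x) * emeasure M (einterval x D)"]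
  by (simp add: delta_def emeasure_N_I mult.commute)

lemma tail_le:
  assumes "x \<in> I"
  shows "emeasure M (einterval x D) \<le> delta a b D * ennreal (1 / \<phi> x)"
proof -
  have pos: "0 < \<phi> x" by (rule phi_pos[OF assms])
  have "emeasure M (einterval x D) = emeasure M (einterval x D) * (ennreal (\<phi> x) * ennreal (1 / \<phi> x))"
    using pos by (simp add: ennreal_mult[symmetric])
  also have "\<dots> \<le> delta a b D * ennreal (1 / \<phi> x)"
    unfolding mult.assoc[symmetric] by (intro mult_right_mono delta_upper assms) simp
  finally show ?thesis .
qed

lemma delta_le_delta1': "delta a b D \<le> delta1' a b D"
  unfolding delta_def delta1'_eq
proof (rule SUP_mono, intro bexI)
  fix t assume t: "t \<in> I"
  have [measurable]: "einterval (ereal t) D \<in> sets M"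
    using t by (auto intro: einterval_sets)
  have pos: "0 < \<phi> t" by (rule phi_pos[OF t])
  have "inverse (ennreal (\<phi> t)) * ennreal ((\<phi> t)\<^sup>2) = ennreal (\<phi> t)"
    using pos by (simp add: inverse_ennreal ennreal_mult[symmetric] power2_eq_square field_simps)
  then have "emeasure N (einterval 0 t) * emeasure M (einterval t D)
      = inverse (ennreal (\<phi> t)) * (ennreal ((\<phi> t)\<^sup>2) * emeasure M (einterval t D))"
    unfolding mult.assoc[symmetric] by (simp only: emeasure_N_I[OF t])
  also have "ennreal ((\<phi> t)\<^sup>2) * emeasure M (einterval t D)
      = (\<integral>\<^sup>+ y. ennreal ((\<phi> t)\<^sup>2) * indicator (einterval t D) y \<partial>M)"
    by (simp add: nn_integral_cmult)
  also have "\<dots> \<le> (\<integral>\<^sup>+ y. ennreal ((\<phi> (min y t))\<^sup>2) \<partial>M)"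
    by (rule nn_integral_mono) (auto simp: einterval_def min_def split: split_indicator)
  finally show "emeasure N (einterval 0 t) * emeasure M (einterval t D)
      \<le> inverse (ennreal (\<phi> t)) * (\<integral>\<^sup>+ y. ennreal ((\<phi> (min y t))\<^sup>2) \<partial>M)"
    by (simp add: mult_left_mono)
qed

text \<open>
  Write \<open>\<phi>(y \<and> t)\<^sup>2\<close> as the integral of \<open>2\<phi> d\<nu>\<close> over \<open>(0, y \<and> t)\<close>. After the exchange of integrals,
  the factor \<open>\<phi>(s) \<mu>(s,D)\<close> is at most \<open>\<delta>\<close>, and what remains has total mass \<open>2\<phi>(t)\<close>.
\<close>
lemma delta1'_le_delta: "delta1' a b D \<le> 2 * delta a b D"
  unfolding delta1'_eq
proof (rule SUP_least)
  fix t assume t: "t \<in> I"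
  have [measurable]: "einterval 0 (ereal t) \<in> sets N"
    using t by (auto intro: einterval_sets)
  have pos: "0 < \<phi> t" by (rule phi_pos[OF t])
  have sq: "ennreal ((\<phi> (min y t))\<^sup>2) = (\<integral>\<^sup>+ s\<in>einterval 0 y. ennreal (2 * \<phi> s) * indicator (einterval 0 t) s \<partial>N)"
    if "y \<in> I" for y
  proof -
    have "(\<integral>\<^sup>+ s\<in>einterval 0 y. ennreal (2 * \<phi> s) * indicator (einterval 0 t) s \<partial>N)
      = (\<integral>\<^sup>+ s\<in>einterval (ereal 0) (min y t). ennreal (2 * \<phi> s) \<partial>N)"
      by (rule nn_integral_cong) (auto simp: einterval_def zero_ereal_def split: split_indicator)
    also have "\<dots> = ennreal ((\<phi> (min y t))\<^sup>2 - (\<phi> 0)\<^sup>2)"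
      using that t by (intro nn_integral_comp_phi[where h = "\<lambda>u. 2 * u" and H = "\<lambda>u. u\<^sup>2"])
        (auto simp: einterval_def min_def intro!: derivative_eq_intros)
    finally show ?thesis by simp
  qed
  have "(\<integral>\<^sup>+ y. ennreal ((\<phi> (min y t))\<^sup>2) \<partial>M)
      = (\<integral>\<^sup>+ y. 1 * (\<integral>\<^sup>+ s\<in>einterval 0 y. ennreal (2 * \<phi> s) * indicator (einterval 0 t) s \<partial>N) \<partial>M)"
    by (rule nn_integral_cong) (simp add: sq)
  also have "\<dots> = (\<integral>\<^sup>+ s. ennreal (2 * \<phi> s) * indicator (einterval 0 t) s * (\<integral>\<^sup>+ y\<in>einterval s D. 1 \<partial>M) \<partial>N)"
    by (rule tonelli_triangle) measurable
  also have "\<dots> \<le> (\<integral>\<^sup>+ s. 2 * delta a b D * indicator (einterval 0 t) s \<partial>N)"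
  proof (rule nn_integral_mono)
    fix s assume "s \<in> space N"
    then have s: "s \<in> I" by simp
    have "(\<integral>\<^sup>+ y\<in>einterval s D. 1 \<partial>M) = emeasure M (einterval s D)"
      using einterval_sets(3)[OF s] by simp
    then have "ennreal (2 * \<phi> s) * (\<integral>\<^sup>+ y\<in>einterval s D. 1 \<partial>M) = 2 * (emeasure M (einterval s D) * ennreal (\<phi> s))"
      by (simp add: ennreal_mult mult_ac)
    also have "\<dots> \<le> 2 * delta a b D"
      by (intro mult_left_mono delta_upper s) simp
    finally show "ennreal (2 * \<phi> s) * indicator (einterval 0 t) s * (\<integral>\<^sup>+ y\<in>einterval s D. 1 \<partial>M)
      \<le> 2 * delta a b D * indicator (einterval 0 t) s"
      by (auto split: split_indicator)
  qed
  also have "\<dots> = 2 * delta a b D * ennreal (\<phi> t)"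
    using t by (subst nn_integral_cmult_indicator) (simp_all add: emeasure_N_I)
  finally have "inverse (ennreal (\<phi> t)) * (\<integral>\<^sup>+ y. ennreal ((\<phi> (min y t))\<^sup>2) \<partial>M)
      \<le> inverse (ennreal (\<phi> t)) * (2 * delta a b D * ennreal (\<phi> t))"
    by (rule mult_left_mono) simp
  also have "\<dots> = 2 * delta a b D * (ennreal (\<phi> t) * inverse (ennreal (\<phi> t)))"
    by (simp only: mult_ac)
  also have "ennreal (\<phi> t) * inverse (ennreal (\<phi> t)) = 1"
    using pos by (simp add: inverse_ennreal ennreal_mult[symmetric])
  finally show "inverse (ennreal (\<phi> t)) * (\<integral>\<^sup>+ y. ennreal ((\<phi> (min y t))\<^sup>2) \<partial>M) \<le> 2 * delta a b D"
    by simp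
qed

text \<open>
  For \<open>y > s\<close> we have \<open>\<surd>\<phi>(y) = \<surd>\<phi>(s) + \<integral>\<^sub>s\<^sup>y d\<nu>/(2\<surd>\<phi>)\<close>. The constant part contributes
  \<open>\<surd>\<phi>(s) \<mu>(s,D) \<le> \<delta>/\<surd>\<phi>(s)\<close>. After the exchange of integrals the other part contributes at most
  \<open>\<delta> \<integral>\<^sub>s\<^sup>D \<phi>\<^bsup>-3/2\<^esup>/2 d\<nu>\<close>, which is again at most \<open>\<delta>/\<surd>\<phi>(s)\<close>.
\<close>
lemma sqrt_phi_tail_le:
  assumes s: "s \<in> I"
  shows "(\<integral>\<^sup>+ y\<in>einterval s D. ennreal (sqrt (\<phi> y)) \<partial>M) \<le> 2 * delta a b D * ennreal (1 / sqrt (\<phi> s))"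
proof -
  have [measurable]: "einterval (ereal s) D \<in> sets M" "einterval (ereal s) D \<in> sets N"
    using s by (auto intro: einterval_sets)
  have s': "0 < s" "ereal s < D" using s by (auto simp: einterval_def)
  have pos: "0 < \<phi> s" by (rule phi_pos[OF s])
  define k where "k t = ennreal (1 / (2 * sqrt (\<phi> t)))" for t
  have [measurable]: "k \<in> borel_measurable N" unfolding k_def by measurable
  \<comment> \<open>The base point \<open>s\<close> is positive, which avoids the singularity of the derivative of \<open>\<surd>\<phi>\<close> at \<open>0\<close>.\<close>
  have sqrt_eq: "ennreal (sqrt (\<phi> y)) = ennreal (sqrt (\<phi> s)) + (\<integral>\<^sup>+ t\<in>einterval s y. k t \<partial>N)"
    if "s < y" "ereal y < D" for y
  proof -
    have "(\<integral>\<^sup>+ t\<in>einterval s y. k t \<partial>N) = ennreal (sqrt (\<phi> y) - sqrt (\<phi> s))"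
      unfolding k_def using that s' pos
      by (intro nn_integral_comp_phi[where h = "\<lambda>u. 1 / (2 * sqrt u)" and H = sqrt])
        (auto intro!: derivative_eq_intros simp: field_simps)
    moreover have "\<phi> s \<le> \<phi> y" using that s' by (intro phi_mono) auto
    ultimately show ?thesis by (simp add: ennreal_plus[symmetric] del: ennreal_plus)
  qed
  have "(\<integral>\<^sup>+ y\<in>einterval s D. ennreal (sqrt (\<phi> y)) \<partial>M)
      = (\<integral>\<^sup>+ y. ennreal (sqrt (\<phi> s)) * indicator (einterval s D) y
          + indicator (einterval s D) y * (\<integral>\<^sup>+ t\<in>einterval 0 y. k t * indicator (einterval s D) t \<partial>N) \<partial>M)"
  proof (rule nn_integral_cong)
    fix y assume "y \<in> space M"
    show "ennreal (sqrt (\<phi> y)) * indicator (einterval s D) y = ennreal (sqrt (\<phi> s)) * indicator (einterval s D) y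
          + indicator (einterval s D) y * (\<integral>\<^sup>+ t\<in>einterval 0 y. k t * indicator (einterval s D) t \<partial>N)"
    proof (cases "y \<in> einterval s D")
      case True
      then have y: "s < y" "ereal y < D" by (auto simp: einterval_def)
      have "(\<integral>\<^sup>+ t\<in>einterval 0 y. k t * indicator (einterval s D) t \<partial>N) = (\<integral>\<^sup>+ t\<in>einterval s y. k t \<partial>N)"
        by (rule nn_integral_cong) (use s' in \<open>auto simp: einterval_def split: split_indicator\<close>)
      then show ?thesis using True sqrt_eq[OF y] by simp
    qed simp
  qed
  also have "\<dots> = (\<integral>\<^sup>+ y. ennreal (sqrt (\<phi> s)) * indicator (einterval s D) y \<partial>M)
          + (\<integral>\<^sup>+ y. indicator (einterval s D) y * (\<integral>\<^sup>+ t\<in>einterval 0 y. k t * indicator (einterval s D) t \<partial>N) \<partial>M)"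
  proof (rule nn_integral_add)
    have [measurable]: "(\<lambda>y. \<integral>\<^sup>+ t\<in>einterval 0 y. k t * indicator (einterval s D) t \<partial>N) \<in> borel_measurable M"
      by (rule nn_integral_primitive_measurable) measurable
    show "(\<lambda>y. indicator (einterval s D) y * (\<integral>\<^sup>+ t\<in>einterval 0 y. k t * indicator (einterval s D) t \<partial>N))
        \<in> borel_measurable M"
      by measurable
  qed measurable
  also have "(\<integral>\<^sup>+ y. ennreal (sqrt (\<phi> s)) * indicator (einterval s D) y \<partial>M)
      \<le> delta a b D * ennreal (1 / sqrt (\<phi> s))"
  proof -
    have "(\<integral>\<^sup>+ y. ennreal (sqrt (\<phi> s)) * indicator (einterval s D) y \<partial>M)
        = ennreal (sqrt (\<phi> s)) * emeasure M (einterval s D)"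
      by (rule nn_integral_cmult_indicator) measurable
    also have "\<dots> \<le> ennreal (sqrt (\<phi> s)) * (delta a b D * ennreal (1 / \<phi> s))"
      by (intro mult_left_mono tail_le s) simp
    also have "\<dots> = delta a b D * (ennreal (sqrt (\<phi> s)) * ennreal (1 / \<phi> s))"
      by (simp only: mult_ac)
    also have "ennreal (sqrt (\<phi> s)) * ennreal (1 / \<phi> s) = ennreal (1 / sqrt (\<phi> s))"
      using pos by (subst ennreal_mult[symmetric]) (auto simp: field_simps)
    finally show ?thesis .
  qed
  also have "(\<integral>\<^sup>+ y. indicator (einterval s D) y * (\<integral>\<^sup>+ t\<in>einterval 0 y. k t * indicator (einterval s D) t \<partial>N) \<partial>M)
      = (\<integral>\<^sup>+ t. k t * indicator (einterval s D) t * (\<integral>\<^sup>+ y\<in>einterval t D. indicator (einterval s D) y \<partial>M) \<partial>N)"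
    by (rule tonelli_triangle) measurable
  also have "\<dots> \<le> (\<integral>\<^sup>+ t. delta a b D * (ennreal (1 / (2 * \<phi> t * sqrt (\<phi> t))) * indicator (einterval s D) t) \<partial>N)"
  proof (rule nn_integral_mono)
    fix t assume "t \<in> space N"
    then have t: "t \<in> I" "0 < \<phi> t" by (auto simp: phi_pos)
    have "(\<integral>\<^sup>+ y\<in>einterval t D. indicator (einterval s D) y \<partial>M) \<le> (\<integral>\<^sup>+ y. indicator (einterval t D) y \<partial>M)"
      by (rule nn_integral_mono) (auto split: split_indicator)
    also have "\<dots> = emeasure M (einterval t D)"
      using einterval_sets(3)[OF t(1)] by simp
    also have "\<dots> \<le> delta a b D * ennreal (1 / \<phi> t)" by (rule tail_le[OF t(1)])
    finally have "k t * (\<integral>\<^sup>+ y\<in>einterval t D. indicator (einterval s D) y \<partial>M)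
        \<le> k t * (delta a b D * ennreal (1 / \<phi> t))"
      by (rule mult_left_mono) simp
    also have "\<dots> = delta a b D * (k t * ennreal (1 / \<phi> t))" by (simp only: mult_ac)
    also have "k t * ennreal (1 / \<phi> t) = ennreal (1 / (2 * \<phi> t * sqrt (\<phi> t)))"
      using t(2) by (simp add: k_def ennreal_mult[symmetric] mult_ac)
    finally show "k t * indicator (einterval s D) t * (\<integral>\<^sup>+ y\<in>einterval t D. indicator (einterval s D) y \<partial>M)
      \<le> delta a b D * (ennreal (1 / (2 * \<phi> t * sqrt (\<phi> t))) * indicator (einterval s D) t)"
      by (auto split: split_indicator)
  qed
  also have "\<dots> = delta a b D * (\<integral>\<^sup>+ t\<in>einterval s D. ennreal (1 / (2 * \<phi> t * sqrt (\<phi> t))) \<partial>N)"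
    by (rule nn_integral_cmult) measurable
  also have "(\<integral>\<^sup>+ t\<in>einterval s D. ennreal (1 / (2 * \<phi> t * sqrt (\<phi> t))) \<partial>N) \<le> ennreal (1 / sqrt (\<phi> s))"
  proof (rule nn_integral_einterval_le)
    fix u y assume uy: "ereal s < ereal u" "u < y" "ereal y < D"
    have mono: "\<phi> s \<le> \<phi> u" using uy s' ereal_less_mono[of u y D] by (intro phi_mono) auto
    have "(\<integral>\<^sup>+ t\<in>einterval u y. ennreal (1 / (2 * \<phi> t * sqrt (\<phi> t))) \<partial>N)
        = ennreal (- (1 / sqrt (\<phi> y)) - - (1 / sqrt (\<phi> u)))"
      using uy s' pos mono
      by (intro nn_integral_comp_phi[where h = "\<lambda>u. 1 / (2 * u * sqrt u)" and H = "\<lambda>u. - (1 / sqrt u)"])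
        (auto intro!: derivative_eq_intros simp: field_simps)
    also have "\<dots> \<le> ennreal (1 / sqrt (\<phi> s))"
    proof (rule ennreal_leI)
      have "1 / sqrt (\<phi> u) \<le> 1 / sqrt (\<phi> s)" using mono pos by (simp add: frac_le)
      moreover have "0 \<le> 1 / sqrt (\<phi> y)" by simp
      ultimately show "- (1 / sqrt (\<phi> y)) - - (1 / sqrt (\<phi> u)) \<le> 1 / sqrt (\<phi> s)" by linarith
    qed
    finally show "(\<integral>\<^sup>+ t\<in>{u<..<y}. ennreal (1 / (2 * \<phi> t * sqrt (\<phi> t))) \<partial>N) \<le> ennreal (1 / sqrt (\<phi> s))"
      by (simp add: einterval_eq_Icc)
  qed (auto simp: sets_N sets_restrict_space)
  finally show ?thesis
    by (simp add: mult_2 distrib_right add_mono mult_left_mono)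
qed

text \<open>
  Integrate the tail estimate \<open>2\<delta>/\<surd>\<phi>(s) = 4\<delta> \<cdot> 1/(2\<surd>\<phi>(s))\<close> over \<open>(0,x)\<close>; the last factor is
  the \<open>\<nu>\<close>-derivative of \<open>\<surd>\<phi>\<close>.
\<close>
lemma delta1_le_delta: "delta1 a b D \<le> 4 * delta a b D"
  unfolding delta1_def
proof (rule SUP_least)
  fix x assume x: "x \<in> I"
  have x': "0 < x" "ereal x < D" using x by (auto simp: einterval_def)
  have pos: "0 < \<phi> x" by (rule phi_pos[OF x])
  have [measurable]: "einterval 0 (ereal x) \<in> sets N"
    using x by (auto intro: einterval_sets)
  have "(\<integral>\<^sup>+ s\<in>einterval 0 x. (\<integral>\<^sup>+ y\<in>einterval s D. ennreal (sqrt (\<phi> y)) \<partial>M) \<partial>N)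
      \<le> (\<integral>\<^sup>+ s. 4 * delta a b D * (ennreal (1 / (2 * sqrt (\<phi> s))) * indicator (einterval 0 x) s) \<partial>N)"
  proof (rule nn_integral_mono)
    fix s assume "s \<in> space N"
    then have s: "s \<in> I" "0 < \<phi> s" by (auto simp: phi_pos)
    have "ennreal (1 / sqrt (\<phi> s)) = ennreal (2 * (1 / (2 * sqrt (\<phi> s))))" by simp
    also have "\<dots> = 2 * ennreal (1 / (2 * sqrt (\<phi> s)))"
      by (subst ennreal_mult) auto
    finally have "2 * delta a b D * ennreal (1 / sqrt (\<phi> s)) = 4 * delta a b D * ennreal (1 / (2 * sqrt (\<phi> s)))"
      by (simp add: mult_ac)
    then show "(\<integral>\<^sup>+ y\<in>einterval s D. ennreal (sqrt (\<phi> y)) \<partial>M) * indicator (einterval 0 x) s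
      \<le> 4 * delta a b D * (ennreal (1 / (2 * sqrt (\<phi> s))) * indicator (einterval 0 x) s)"
      using sqrt_phi_tail_le[OF s(1)] by (auto split: split_indicator)
  qed
  also have "\<dots> = 4 * delta a b D * (\<integral>\<^sup>+ s\<in>einterval 0 x. ennreal (1 / (2 * sqrt (\<phi> s))) \<partial>N)"
    by (rule nn_integral_cmult) measurable
  also have "(\<integral>\<^sup>+ s\<in>einterval 0 x. ennreal (1 / (2 * sqrt (\<phi> s))) \<partial>N) \<le> ennreal (sqrt (\<phi> x))"
  proof (rule nn_integral_einterval_le)
    fix u y assume uy: "0 < ereal u" "u < y" "ereal y < ereal x"
    have D: "ereal y < D" "ereal u < D" using uy x' ereal_less_mono[of y x D] ereal_less_mono[of u x D] by auto
    have "0 < \<phi> u" using uy D by (intro phi_pos) (simp add: einterval_def)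
    have "(\<integral>\<^sup>+ t\<in>einterval u y. ennreal (1 / (2 * sqrt (\<phi> t))) \<partial>N) = ennreal (sqrt (\<phi> y) - sqrt (\<phi> u))"
      using uy D \<open>0 < \<phi> u\<close>
      by (intro nn_integral_comp_phi[where h = "\<lambda>u. 1 / (2 * sqrt u)" and H = sqrt])
        (auto intro!: derivative_eq_intros simp: field_simps)
    also have "\<dots> \<le> ennreal (sqrt (\<phi> x))"
    proof (rule ennreal_leI)
      have "\<phi> y \<le> \<phi> x" using uy x' by (intro phi_mono) auto
      then have "sqrt (\<phi> y) \<le> sqrt (\<phi> x)" by simp
      moreover have "0 \<le> sqrt (\<phi> u)" by simp
      ultimately show "sqrt (\<phi> y) - sqrt (\<phi> u) \<le> sqrt (\<phi> x)" by linarith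
    qed
    finally show "(\<integral>\<^sup>+ t\<in>{u<..<y}. ennreal (1 / (2 * sqrt (\<phi> t))) \<partial>N) \<le> ennreal (sqrt (\<phi> x))"
      by (simp add: einterval_eq_Icc)
  qed (auto simp: sets_N sets_restrict_space)
  finally have "II a b D (\<lambda>y. sqrt (\<phi> y)) x \<le> 4 * delta a b D * ennreal (sqrt (\<phi> x)) / ennreal (sqrt (\<phi> x))"
    unfolding II_def by (auto intro!: divide_right_mono_ennreal simp: mult_left_mono)
  also have "\<dots> = 4 * delta a b D"
    using pos by (intro mult_divide_eq_ennreal) auto
  finally show "II a b D (\<lambda>y. sqrt (\<phi> y)) x \<le> 4 * delta a b D" .
qed

section \<open>The lower bound: a Hardy inequality\<close>

lemma nn_integral_tail_measurable:
  assumes [measurable]: "k \<in> borel_measurable M"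
  shows "(\<lambda>s. \<integral>\<^sup>+ y\<in>einterval s D. k y \<partial>M) \<in> borel_measurable N"
proof -
  have "(\<lambda>s. \<integral>\<^sup>+ y. (if s < y then k y else 0) \<partial>M) \<in> borel_measurable N"
    by measurable
  then show ?thesis
    by (rule measurable_cong[THEN iffD1, rotated])
       (auto intro!: nn_integral_cong simp: einterval_def split: split_indicator)
qed

text \<open>
  The weight \<open>G\<close> of the Cauchy--Schwarz step. Its \<open>\<nu>\<close>-integral over \<open>(0,x)\<close> is
  \<open>\<surd>\<phi>(x) \<cdot> II(\<surd>\<phi>)(x)\<close>, which is where \<open>\<delta>\<^sub>1\<close> enters.
\<close>
definition sqrt_phi_tail :: "real \<Rightarrow> ennreal" where
  "sqrt_phi_tail s = (\<integral>\<^sup>+ y\<in>einterval s D. ennreal (sqrt (\<phi> y)) \<partial>M)"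

lemma sqrt_phi_tail_measurable [measurable]: "sqrt_phi_tail \<in> borel_measurable N"
  unfolding sqrt_phi_tail_def by (rule nn_integral_tail_measurable) measurable

lemma sqrt_phi_tail_antimono: "s \<le> t \<Longrightarrow> sqrt_phi_tail t \<le> sqrt_phi_tail s"
  unfolding sqrt_phi_tail_def by (intro nn_integral_mono) (auto simp: einterval_def split: split_indicator)

lemma sqrt_phi_tail_pos:
  assumes s: "s \<in> I"
  shows "0 < sqrt_phi_tail s"
proof (rule ccontr)
  have s': "0 < s" "ereal s < D" using s by (auto simp: einterval_def)
  obtain y where y: "s < y" "ereal y < D" using ereal_dense2[OF s'(2)] by auto
  have [measurable]: "einterval (ereal s) D \<in> sets M" using s by (rule einterval_sets)
  assume "\<not> 0 < sqrt_phi_tail s"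
  then have "(\<integral>\<^sup>+ y. ennreal (sqrt (\<phi> y)) * indicator (einterval s D) y \<partial>M) = 0"
    by (simp add: sqrt_phi_tail_def)
  then have "AE y in M. ennreal (sqrt (\<phi> y)) * indicator (einterval s D) y = 0"
    by (subst (asm) nn_integral_0_iff_AE) measurable
  then have "AE t in restrict_space lborel I. ennreal (exp (C t) / a t) > 0 \<longrightarrow>
      ennreal (sqrt (\<phi> t)) * indicator (einterval s D) t = 0"
    unfolding mu_def by (subst (asm) AE_density[OF mu_density_measurable]) simp
  then have "AE t in lborel. t \<in> I \<longrightarrow> ennreal (exp (C t) / a t) > 0 \<longrightarrow>
      ennreal (sqrt (\<phi> t)) * indicator (einterval s D) t = 0"
    by (subst (asm) AE_restrict_space_iff) auto
  then have "AE t in lborel. t \<notin> {s<..<y}"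
  proof eventually_elim
    case (elim t)
    show ?case
    proof
      assume t: "t \<in> {s<..<y}"
      then have "ereal t < D" using y(2) ereal_less_mono[of t y D] by auto
      then have "t \<in> I" "t \<in> einterval s D" using t s' by (auto simp: einterval_def)
      then show False using elim phi_pos[of t] a_pos[of t] by simp
    qed
  qed
  then have "emeasure lborel {s<..<y} = 0"
    using AE_iff_null_sets[of "{s<..<y}" lborel] by (auto simp: null_sets_def)
  then show False using y by simp
qed

lemma nn_integral_sqrt_phi_tail_le:
  assumes x: "x \<in> I"
  shows "(\<integral>\<^sup>+ s\<in>einterval 0 x. sqrt_phi_tail s \<partial>N) \<le> delta1 a b D * ennreal (sqrt (\<phi> x))"
proof -
  have pos: "0 < \<phi> x" by (rule phi_pos[OF x])
  have "(\<integral>\<^sup>+ s\<in>einterval 0 x. sqrt_phi_tail s \<partial>N) = II a b D (\<lambda>y. sqrt (\<phi> y)) x * ennreal (sqrt (\<phi> x))"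
    using pos unfolding II_def sqrt_phi_tail_def[symmetric]
    by (simp add: divide_ennreal_def mult.assoc inverse_ennreal ennreal_mult[symmetric])
  also have "\<dots> \<le> delta1 a b D * ennreal (sqrt (\<phi> x))"
    unfolding delta1_def by (intro mult_right_mono SUP_upper x) simp
  finally show ?thesis .
qed

text \<open>
  The weight decreases, so an infinite value at \<open>x\<close> would make its integral over \<open>(0,x)\<close> infinite.
\<close>
lemma sqrt_phi_tail_finite:
  assumes fin: "delta1 a b D < \<infinity>" and x: "x \<in> I"
  shows "sqrt_phi_tail x < \<infinity>"
proof (rule ccontr)
  assume "\<not> sqrt_phi_tail x < \<infinity>"
  then have inf: "sqrt_phi_tail x = \<infinity>" by (simp add: less_top[symmetric])
  have [measurable]: "einterval 0 (ereal x) \<in> sets N" using x by (rule einterval_sets)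
  have "(\<infinity> :: ennreal) = (\<integral>\<^sup>+ s. sqrt_phi_tail x * indicator (einterval 0 x) s \<partial>N)"
    using phi_pos[OF x]
    by (subst nn_integral_cmult_indicator) (simp_all add: emeasure_N_I[OF x] inf ennreal_top_mult)
  also have "\<dots> \<le> (\<integral>\<^sup>+ s\<in>einterval 0 x. sqrt_phi_tail s \<partial>N)"
    by (rule nn_integral_mono) (auto simp: einterval_def intro: sqrt_phi_tail_antimono split: split_indicator)
  also have "\<dots> \<le> delta1 a b D * ennreal (sqrt (\<phi> x))"
    by (rule nn_integral_sqrt_phi_tail_le[OF x])
  also have "\<dots> < \<infinity>" using fin by (simp add: ennreal_mult_less_top)
  finally show False by simp
qed

lemma C_measurable [measurable]: "C \<in> borel_measurable M" "C \<in> borel_measurable N"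
  using borel_measurable_continuous_on_restrict[OF continuous_C_interior]
  unfolding measurable_cong_sets[OF sets_M refl] measurable_cong_sets[OF sets_N refl] by auto

lemma a_measurable_M [measurable]: "a \<in> borel_measurable M"
  using measurable_restrict_mono[OF a_meas I_subset]
  unfolding measurable_cong_sets[OF sets_M refl] .

lemma C1_deriv:
  assumes f: "f C1_differentiable_on I"
  shows "continuous_on I (deriv f)" "\<And>x. x \<in> I \<Longrightarrow> (f has_real_derivative deriv f x) (at x)"
proof -
  obtain d where d: "\<And>x. x \<in> I \<Longrightarrow> (f has_vector_derivative d x) (at x)" "continuous_on I d"
    using f unfolding C1_differentiable_on_def by auto
  have eq: "deriv f x = d x" if "x \<in> I" for x
    using d(1)[OF that] by (intro DERIV_imp_deriv) (simp add: has_real_derivative_iff_has_vector_derivative)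
  show "continuous_on I (deriv f)" using d(2) by (subst continuous_on_cong[OF refl eq]) auto
  show "(f has_real_derivative deriv f x) (at x)" if "x \<in> I" for x
    using d(1)[OF that] eq[OF that] by (simp add: has_real_derivative_iff_has_vector_derivative)
qed

lemma deriv_measurable:
  assumes f: "f C1_differentiable_on I"
  shows "deriv f \<in> borel_measurable M" "deriv f \<in> borel_measurable N"
  using borel_measurable_continuous_on_restrict[OF C1_deriv(1)[OF f]]
  unfolding measurable_cong_sets[OF sets_M refl] measurable_cong_sets[OF sets_N refl] by auto

text \<open>
  Both integrals equal \<open>\<integral> e\<^sup>C f'\<^sup>2 dx\<close>. Rewriting the energy as a \<open>\<nu>\<close>-integral of the square of
  \<open>p = e\<^sup>C |f'|\<close> puts it in the form in which Tonelli's theorem can be applied.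
\<close>
lemma energy_eq:
  assumes f: "f C1_differentiable_on I"
  shows "energy a b D f = (\<integral>\<^sup>+ s. ennreal ((exp (C s) * \<bar>deriv f s\<bar>)\<^sup>2) \<partial>N)"
proof -
  note [measurable] = deriv_measurable[OF f]
  have "energy a b D f = (\<integral>\<^sup>+ t\<in>I. ennreal (exp (C t) / a t) * ennreal (a t * (deriv f t)\<^sup>2) \<partial>lborel)"
    unfolding energy_def by (rule nn_integral_M) measurable
  also have "\<dots> = (\<integral>\<^sup>+ t\<in>I. ennreal (exp (- C t)) * ennreal ((exp (C t) * \<bar>deriv f t\<bar>)\<^sup>2) \<partial>lborel)"
  proof (rule nn_integral_cong)
    fix t
    show "ennreal (exp (C t) / a t) * ennreal (a t * (deriv f t)\<^sup>2) * indicator I t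
        = ennreal (exp (- C t)) * ennreal ((exp (C t) * \<bar>deriv f t\<bar>)\<^sup>2) * indicator I t"
    proof (cases "t \<in> I")
      case True
      then have "0 < a t" by (rule a_pos)
      have eq: "(exp (C t) * \<bar>deriv f t\<bar>)\<^sup>2 = exp (C t) * (exp (C t) * (deriv f t)\<^sup>2)"
        by (simp add: power_mult_distrib power2_eq_square[of "exp (C t)"])
      show ?thesis
        unfolding eq using \<open>0 < a t\<close> by (simp add: ennreal_mult[symmetric] exp_minus field_simps)
    qed simp
  qed
  also have "\<dots> = (\<integral>\<^sup>+ s. ennreal ((exp (C s) * \<bar>deriv f s\<bar>)\<^sup>2) \<partial>N)"
    by (rule nn_integral_N[symmetric]) measurable
  finally show ?thesis .
qed

lemma increment_le:
  assumes f: "f C1_differentiable_on I" and e: "0 < e" "e \<le> x" "ereal x < D"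
  shows "ennreal \<bar>f x - f e\<bar> \<le> (\<integral>\<^sup>+ s\<in>einterval e x. ennreal (exp (C s) * \<bar>deriv f s\<bar>) \<partial>N)"
proof -
  note [measurable] = deriv_measurable[OF f]
  have sub: "{e..x} \<subseteq> I"
    using e ereal_less_mono[OF _ e(3)] by (auto simp: einterval_def)
  have bi: "has_bochner_integral lborel (\<lambda>s. indicator {e..x} s *\<^sub>R deriv f s) (f x - f e)"
  proof (rule has_bochner_integral_FTC_Icc[OF e(2)])
    show "continuous_on {e..x} (deriv f)"
      by (rule continuous_on_subset[OF C1_deriv(1)[OF f] sub])
    show "(f has_vector_derivative deriv f s) (at s within {e..x})" if "e \<le> s" "s \<le> x" for s
    proof -
      have "s \<in> I" using that sub by auto
      from C1_deriv(2)[OF f this] show ?thesis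
        by (simp add: has_real_derivative_iff_has_vector_derivative has_vector_derivative_at_within)
    qed
  qed
  have "ennreal \<bar>f x - f e\<bar> \<le> (\<integral>\<^sup>+ s. ennreal (norm (indicator {e..x} s *\<^sub>R deriv f s)) \<partial>lborel)"
    using has_bochner_integral_norm_bound[OF bi] by simp
  also have "\<dots> = (\<integral>\<^sup>+ s\<in>{e..x}. ennreal (exp (- C s)) * ennreal (exp (C s) * \<bar>deriv f s\<bar>) \<partial>lborel)"
    by (rule nn_integral_cong)
       (auto simp: ennreal_mult[symmetric] exp_minus split: split_indicator)
  also have "\<dots> = (\<integral>\<^sup>+ s\<in>einterval e x. ennreal (exp (C s) * \<bar>deriv f s\<bar>) \<partial>N)"
    using e by (intro nn_integral_N_einterval[symmetric]) auto
  finally show ?thesis .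
qed

text \<open>
  Cauchy--Schwarz bounds the increment of \<open>f\<close> over \<open>[e,x]\<close>; since \<open>f\<close> is assumed differentiable
  only on the open interval, \<open>f(0) = 0\<close> is used through the limit \<open>e \<rightarrow> 0\<close>.
\<close>
lemma square_le_weighted_energy:
  assumes f: "f C1_differentiable_on I" "continuous_on (closed_ivl D) f" "f 0 = 0"
    and fin: "delta1 a b D < \<infinity>" and x: "x \<in> I"
  shows "ennreal ((f x)\<^sup>2)
    \<le> (\<integral>\<^sup>+ s\<in>einterval 0 x. ennreal ((exp (C s) * \<bar>deriv f s\<bar>)\<^sup>2 / enn2real (sqrt_phi_tail s)) \<partial>N) * (\<integral>\<^sup>+ s\<in>einterval 0 x. sqrt_phi_tail s \<partial>N)"
    (is "_ \<le> ?K")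
proof (cases "?K = \<infinity>")
  case False
  then obtain k where k: "?K = ennreal k" "0 \<le> k" by (cases "?K") auto
  note [measurable] = deriv_measurable[OF f(1)]
  have x': "0 < x" "ereal x < D" using x by (auto simp: einterval_def)
  let ?p = "\<lambda>s. exp (C s) * \<bar>deriv f s\<bar>"
  \<comment> \<open>On \<open>(0,D)\<close> the weight is positive and finite, so the conversion to a real number loses nothing.\<close>
  have sqrt_phi_tail_real: "0 < enn2real (sqrt_phi_tail s)" "ennreal (enn2real (sqrt_phi_tail s)) = sqrt_phi_tail s" if "s \<in> I" for s
    using sqrt_phi_tail_pos[OF that] sqrt_phi_tail_finite[OF fin that] by (auto simp: enn2real_positive_iff)
  have le: "(f x - f e)\<^sup>2 \<le> k" if e: "0 < e" "e \<le> x" for e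
  proof -
    have sub: "einterval (ereal e) (ereal x) \<subseteq> einterval 0 (ereal x)" "einterval 0 (ereal x) \<subseteq> I"
      using e x' ereal_less_mono[OF less_imp_le x'(2)] by (auto simp: einterval_def)
    have [measurable]: "einterval (ereal e) (ereal x) \<in> sets N"
      using sub by (simp add: sets_N sets_restrict_space_iff)
    have "ennreal ((f x - f e)\<^sup>2) = (ennreal \<bar>f x - f e\<bar>)\<^sup>2"
      by (simp add: ennreal_power)
    also have "\<dots> \<le> (\<integral>\<^sup>+ s\<in>einterval e x. ennreal (?p s) \<partial>N)\<^sup>2"
      by (intro power_mono increment_le f e x') simp
    also have "\<dots> \<le> (\<integral>\<^sup>+ s\<in>einterval e x. ennreal ((?p s)\<^sup>2 / enn2real (sqrt_phi_tail s)) \<partial>N)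
        * (\<integral>\<^sup>+ s\<in>einterval e x. ennreal (enn2real (sqrt_phi_tail s)) \<partial>N)"
      by (rule Cauchy_Schwarz_weighted[OF _ _ \<open>einterval e x \<in> sets N\<close>]) (use sqrt_phi_tail_real in auto)
    also have "\<dots> \<le> ?K"
    proof (rule mult_mono)
      show "(\<integral>\<^sup>+ s\<in>einterval e x. ennreal ((?p s)\<^sup>2 / enn2real (sqrt_phi_tail s)) \<partial>N)
          \<le> (\<integral>\<^sup>+ s\<in>einterval 0 x. ennreal ((?p s)\<^sup>2 / enn2real (sqrt_phi_tail s)) \<partial>N)"
        by (rule nn_integral_mono) (use sub in \<open>auto split: split_indicator\<close>)
      show "(\<integral>\<^sup>+ s\<in>einterval e x. ennreal (enn2real (sqrt_phi_tail s)) \<partial>N) \<le> (\<integral>\<^sup>+ s\<in>einterval 0 x. sqrt_phi_tail s \<partial>N)"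
        by (rule nn_integral_mono) (use sub sqrt_phi_tail_real(2) in \<open>auto split: split_indicator\<close>)
    qed simp_all
    finally show ?thesis using k by (simp add: ennreal_le_iff)
  qed
  have "{0..x} \<subseteq> closed_ivl D"
    using x' ereal_less_mono[OF _ x'(2)] by (auto simp: closed_ivl_def less_imp_le)
  then have "continuous_on {0..x} f" by (rule continuous_on_subset[OF f(2)])
  then have "(f \<longlongrightarrow> f 0) (at 0 within {0..x})"
    using x' by (auto simp: continuous_on_def)
  then have "(f \<longlongrightarrow> 0) (at_right 0)"
    using x' f(3) by (simp add: at_within_Icc_at_right)
  then have "((\<lambda>e. (f x - f e)\<^sup>2) \<longlongrightarrow> (f x - 0)\<^sup>2) (at_right 0)"
    by (intro tendsto_intros)
  moreover have "\<forall>\<^sub>F e in at_right 0. (f x - f e)\<^sup>2 \<le> k"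
    using eventually_at_right_real[OF x'(1)] by eventually_elim (auto intro: le)
  ultimately have "(f x - 0)\<^sup>2 \<le> k"
    by (rule tendsto_upperbound) simp
  then show ?thesis using k by (simp add: ennreal_leI)
qed (simp add: top_unique)

text \<open>
  Integrating the pointwise bound and exchanging the integrals, the weight \<open>1/G\<close> meets the factor
  \<open>\<integral>\<^sub>s\<^sup>D \<surd>\<phi> d\<mu> = G(s)\<close> and cancels.
\<close>
lemma hardy_inequality:
  assumes f: "f C1_differentiable_on I" "continuous_on (closed_ivl D) f" "f 0 = 0"
    and fin: "delta1 a b D < \<infinity>"
  shows "(\<integral>\<^sup>+ x. ennreal ((f x)\<^sup>2) \<partial>M) \<le> delta1 a b D * energy a b D f"
proof -
  note [measurable] = deriv_measurable[OF f(1)]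
  define k where "k s = ennreal ((exp (C s) * \<bar>deriv f s\<bar>)\<^sup>2 / enn2real (sqrt_phi_tail s))" for s
  have [measurable]: "k \<in> borel_measurable N" unfolding k_def by measurable
  have k_tail: "k s * sqrt_phi_tail s = ennreal ((exp (C s) * \<bar>deriv f s\<bar>)\<^sup>2)" if "s \<in> I" for s
  proof -
    have *: "0 < enn2real (sqrt_phi_tail s)" "sqrt_phi_tail s = ennreal (enn2real (sqrt_phi_tail s))"
      using sqrt_phi_tail_pos[OF that] sqrt_phi_tail_finite[OF fin that] by (auto simp: enn2real_positive_iff)
    show ?thesis
      unfolding k_def using *(1) by (subst (2) *(2), subst ennreal_mult[symmetric]) auto
  qed
  have [measurable]: "(\<lambda>y. \<integral>\<^sup>+ s\<in>einterval 0 y. k s \<partial>N) \<in> borel_measurable M"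
    by (rule nn_integral_primitive_measurable) measurable
  have "(\<integral>\<^sup>+ x. ennreal ((f x)\<^sup>2) \<partial>M)
      \<le> (\<integral>\<^sup>+ x. delta1 a b D * (ennreal (sqrt (\<phi> x)) * (\<integral>\<^sup>+ s\<in>einterval 0 x. k s \<partial>N)) \<partial>M)"
  proof (rule nn_integral_mono)
    fix x assume "x \<in> space M"
    then have x: "x \<in> I" by simp
    have "ennreal ((f x)\<^sup>2) \<le> (\<integral>\<^sup>+ s\<in>einterval 0 x. k s \<partial>N) * (\<integral>\<^sup>+ s\<in>einterval 0 x. sqrt_phi_tail s \<partial>N)"
      unfolding k_def by (rule square_le_weighted_energy[OF f fin x])
    also have "\<dots> \<le> (\<integral>\<^sup>+ s\<in>einterval 0 x. k s \<partial>N) * (delta1 a b D * ennreal (sqrt (\<phi> x)))"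
      by (intro mult_left_mono nn_integral_sqrt_phi_tail_le x) simp
    finally show "ennreal ((f x)\<^sup>2) \<le> delta1 a b D * (ennreal (sqrt (\<phi> x)) * (\<integral>\<^sup>+ s\<in>einterval 0 x. k s \<partial>N))"
      by (simp only: mult_ac)
  qed
  also have "\<dots> = delta1 a b D * (\<integral>\<^sup>+ x. ennreal (sqrt (\<phi> x)) * (\<integral>\<^sup>+ s\<in>einterval 0 x. k s \<partial>N) \<partial>M)"
    by (rule nn_integral_cmult) measurable
  also have "(\<integral>\<^sup>+ x. ennreal (sqrt (\<phi> x)) * (\<integral>\<^sup>+ s\<in>einterval 0 x. k s \<partial>N) \<partial>M) = (\<integral>\<^sup>+ s. k s * sqrt_phi_tail s \<partial>N)"
    unfolding sqrt_phi_tail_def by (rule tonelli_triangle) measurable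
  also have "\<dots> = energy a b D f"
    unfolding energy_eq[OF f(1)] by (rule nn_integral_cong) (simp add: k_tail)
  finally show ?thesis .
qed

text \<open>
  Zero energy forces all increments to vanish, so \<open>f\<close> is constant, and the constant is \<open>f(0) = 0\<close>.
  This excludes the quotient \<open>0/0\<close>, whose value in the extended nonnegative reals is \<open>0\<close>.
\<close>
lemma energy_pos:
  assumes f: "f C1_differentiable_on I" "continuous_on (closed_ivl D) f" "f 0 = 0"
    and nz: "x \<in> closed_ivl D" "f x \<noteq> 0"
  shows "0 < energy a b D f"
proof (rule ccontr)
  assume "\<not> 0 < energy a b D f"
  note [measurable] = deriv_measurable[OF f(1)]
  let ?p = "\<lambda>s. exp (C s) * \<bar>deriv f s\<bar>"
  have "(\<integral>\<^sup>+ s. ennreal ((?p s)\<^sup>2) \<partial>N) = 0"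
    using \<open>\<not> 0 < energy a b D f\<close> energy_eq[OF f(1)] by simp
  then have AE: "AE s in N. ?p s = 0"
    by (subst (asm) nn_integral_0_iff_AE) (auto elim!: eventually_mono)
  have x: "0 < x" "ereal x \<le> D"
    using nz f(3) by (auto simp: closed_ivl_def less_le)
  have below: "ereal t < D" if "t < x" for t
    using that x(2) by (meson less_ereal.simps(1) less_le_trans)
  have le: "f t = f e" if "0 < e" "e \<le> t" "t < x" for e t
  proof -
    have "ennreal \<bar>f t - f e\<bar> \<le> (\<integral>\<^sup>+ s\<in>einterval e t. ennreal (?p s) \<partial>N)"
      by (rule increment_le[OF f(1) that(1,2) below[OF that(3)]])
    also have "\<dots> = (\<integral>\<^sup>+ s. 0 \<partial>N)"
      using AE by (intro nn_integral_cong_AE, eventually_elim) simp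
    finally show ?thesis by simp
  qed
  have const: "f t = f (x / 2)" if "t \<in> {0<..<x}" for t
    using that x(1) le[of t "x/2"] le[of "x/2" t] by (cases "t \<le> x/2") auto
  \<comment> \<open>The point \<open>x\<close> may be the end point \<open>D\<close>, so the constant value is carried there by continuity.\<close>
  have closure: "closure {0<..<x} = {0..x}" using x(1) by simp
  have "{0..x} \<subseteq> closed_ivl D"
    using x(2) by (auto simp: closed_ivl_def intro: order.trans[of "ereal _" "ereal x"])
  then have cont: "continuous_on (closure {0<..<x}) f"
    unfolding closure by (rule continuous_on_subset[OF f(2)])
  have "f t = f (x / 2)" if "t \<in> {0..x}" for t
    using continuous_constant_on_closure[OF cont const, of t] that unfolding closure by simp
  from this[of 0] this[of x] show False
    using x(1) f(3) nz(2) by simp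
qed

lemma inverse_delta1_le_lambda0: "inverse (delta1 a b D) \<le> lambda0 a b D"
  unfolding lambda0_def
proof (rule Inf_greatest, safe)
  fix f x
  assume f: "f C1_differentiable_on I" "continuous_on (closed_ivl D) f" "f 0 = 0"
    and E: "energy a b D f < \<infinity>" and nz: "x \<in> closed_ivl D" "f x \<noteq> 0"
  define S where "S = (\<integral>\<^sup>+ x. ennreal ((f x)\<^sup>2) \<partial>M)"
  have pos: "0 < energy a b D f" by (rule energy_pos[OF f nz])
  have "inverse (delta1 a b D) \<le> energy a b D f / S"
  proof (cases "delta1 a b D = \<infinity> \<or> S = 0")
    case True
    then show ?thesis using pos by (auto simp: ennreal_divide_eq_top_iff)
  next
    case False
    then have fin: "delta1 a b D < \<infinity>" and S: "S \<noteq> 0" by (auto simp: less_top)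
    have le: "S \<le> delta1 a b D * energy a b D f"
      unfolding S_def by (rule hardy_inequality[OF f fin])
    then have d: "delta1 a b D \<noteq> 0" using S by auto
    have "S < \<infinity>" using le fin E by (metis ennreal_mult_less_top infinity_ennreal_def le_less_trans)
    then have "inverse (delta1 a b D) = inverse (delta1 a b D) * S / S"
      using S by (intro mult_divide_eq_ennreal[symmetric]) auto
    also have "\<dots> \<le> inverse (delta1 a b D) * (delta1 a b D * energy a b D f) / S"
      by (intro divide_right_mono_ennreal mult_left_mono le) simp
    also have "inverse (delta1 a b D) * (delta1 a b D * energy a b D f) = (delta1 a b D / delta1 a b D) * energy a b D f"
      by (simp add: divide_ennreal_def mult_ac)
    also have "delta1 a b D / delta1 a b D = 1"
      using d fin by simp
    finally show ?thesis by simp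
  qed
  then show "inverse (delta1 a b D) \<le> energy a b D f / (\<integral>\<^sup>+ x. ennreal ((f x)\<^sup>2) \<partial>M)"
    by (simp add: S_def)
qed

section \<open>The upper bound: truncated test functions\<close>

text \<open>
  The function with derivative \<open>e\<^bsup>-C\<^esup>\<close> times a continuous cutoff that is \<open>1\<close> on \<open>[0,t]\<close> and \<open>0\<close>
  on \<open>[y,D]\<close>: a \<open>C\<^sup>1\<close> majorant of \<open>\<phi>(\<cdot> \<and> t)\<close>. Its energy density with respect to \<open>\<nu>\<close> is the squared
  cutoff, which is bounded by the indicator of \<open>(0,y)\<close>.
\<close>
lemma cutoff_test_function:
  assumes t: "0 < t" "t < y" "ereal y < D"
  obtains f where "f C1_differentiable_on I" "continuous_on (closed_ivl D) f" "f 0 = 0"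
    "energy a b D f \<le> ennreal (\<phi> y)" "\<And>x. x \<in> I \<Longrightarrow> \<phi> (min x t) \<le> f x"
proof -
  have y: "0 \<le> y" "ereal y < D" using t by auto
  have yI: "y \<in> I" using t by (simp add: einterval_def)
  obtain \<Phi> g where *: "continuous_on UNIV g" "\<And>s. g s > 0"
    "\<And>s. s \<in> {0..y} \<Longrightarrow> g s = exp (- C s)" "\<And>s. (\<Phi> has_real_derivative g s) (at s)"
    and eq: "\<And>s. s \<in> {0..y} \<Longrightarrow> \<phi> s = \<Phi> s"
    using phi_extension[OF y] by metis
  define cut where "cut s = max 0 (min 1 ((y - s) / (y - t)))" for s
  have cut: "0 \<le> cut s" "cut s \<le> 1" "s \<le> t \<Longrightarrow> cut s = 1" "y \<le> s \<Longrightarrow> cut s = 0" for s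
    using t by (auto simp: cut_def min_def max_def field_simps)
  define h where "h s = g s * cut s" for s
  have cont: "continuous_on UNIV h"
    unfolding h_def cut_def using t by (intro continuous_intros *(1)) auto
  obtain F where F: "\<And>s. (F has_vector_derivative h s) (at s)"
    using einterval_antiderivative[of "-\<infinity>" \<infinity> h] cont
    by (auto simp: continuous_on_eq_continuous_at)
  define f where "f s = F s - F 0" for s
  have deriv: "(f has_real_derivative h s) (at s)" for s
    using F[of s] unfolding f_def
    by (auto simp: has_real_derivative_iff_has_vector_derivative intro!: derivative_eq_intros)
  have deriv_eq: "deriv f s = h s" for s by (rule DERIV_imp_deriv[OF deriv])
  have C1: "f C1_differentiable_on I"
    unfolding C1_differentiable_on_def
    using deriv continuous_on_subset[OF cont]
    by (auto simp: has_real_derivative_iff_has_vector_derivative)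
  show thesis
  proof (rule that[of f])
    show "f C1_differentiable_on I" by (rule C1)
    show "continuous_on (closed_ivl D) f"
      using deriv by (meson DERIV_isCont continuous_at_imp_continuous_on)
    show "f 0 = 0" by (simp add: f_def)
    have "energy a b D f \<le> (\<integral>\<^sup>+ s. indicator (einterval 0 y) s \<partial>N)"
      unfolding energy_eq[OF C1] deriv_eq
    proof (rule nn_integral_mono)
      fix s assume "s \<in> space N"
      then have s: "0 < s" by (simp add: einterval_def)
      show "ennreal ((exp (C s) * \<bar>h s\<bar>)\<^sup>2) \<le> indicator (einterval 0 y) s"
      proof (cases "s < y")
        case True
        have "exp (C s) * \<bar>h s\<bar> = cut s"
          using *(3)[of s] s True cut(1)[of s] by (simp add: h_def abs_mult exp_minus)
        then have "(exp (C s) * \<bar>h s\<bar>)\<^sup>2 \<le> 1"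
          using cut(1,2)[of s] by (simp add: power_le_one)
        then show ?thesis using s True by (simp add: einterval_def)
      next
        case False
        then show ?thesis using cut(4)[of s] by (simp add: h_def)
      qed
    qed
    also have "\<dots> = ennreal (\<phi> y)"
      using emeasure_N_I[OF yI] einterval_sets(2)[OF yI] by simp
    finally show "energy a b D f \<le> ennreal (\<phi> y)" .
    show "\<phi> (min x t) \<le> f x" if "x \<in> I" for x
    proof -
      have x: "0 < x" using that by (simp add: einterval_def)
      let ?m = "min x t"
      \<comment> \<open>\<open>f\<close> and \<open>\<phi>\<close> have the same derivative on \<open>[0,t]\<close>, and \<open>f\<close> still increases afterwards.\<close>
      have "f 0 - \<Phi> 0 \<le> f ?m - \<Phi> ?m"
      proof (rule DERIV_nonneg_imp_nondecreasing[of 0 ?m "\<lambda>s. f s - \<Phi> s"])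
        fix s assume "0 \<le> s" "s \<le> ?m"
        then have "h s - g s = 0" using cut(3)[of s] by (simp add: h_def)
        moreover have "((\<lambda>s. f s - \<Phi> s) has_real_derivative h s - g s) (at s)"
          by (intro derivative_intros deriv *(4))
        ultimately show "\<exists>d. ((\<lambda>s. f s - \<Phi> s) has_real_derivative d) (at s) \<and> 0 \<le> d" by force
      qed (use x t in auto)
      moreover have "\<Phi> 0 = 0" "\<Phi> ?m = \<phi> ?m" using eq[of 0] eq[of ?m] x t by auto
      moreover have "f ?m \<le> f x"
      proof (rule DERIV_nonneg_imp_nondecreasing[of ?m x f])
        fix s show "\<exists>d. (f has_real_derivative d) (at s) \<and> 0 \<le> d"
          using deriv[of s] cut(1)[of s] *(2)[of s] by (intro exI[of _ "h s"]) (simp add: h_def)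
      qed simp
      ultimately show ?thesis by (simp add: f_def)
    qed
  qed
qed

lemma lambda0_le_truncated:
  assumes t: "t \<in> I" and y: "t < y" "ereal y < D"
  shows "lambda0 a b D \<le> ennreal (\<phi> y) / (\<integral>\<^sup>+ x. ennreal ((\<phi> (min x t))\<^sup>2) \<partial>M)"
proof -
  have t': "0 < t" "ereal t < D" using t by (auto simp: einterval_def)
  obtain f where f: "f C1_differentiable_on I" "continuous_on (closed_ivl D) f" "f 0 = 0"
    "energy a b D f \<le> ennreal (\<phi> y)" "\<And>x. x \<in> I \<Longrightarrow> \<phi> (min x t) \<le> f x"
    using cutoff_test_function[OF t'(1) y] by metis
  have "f t \<noteq> 0" using f(5)[OF t] phi_pos[OF t] by simp
  then have "\<exists>x\<in>closed_ivl D. f x \<noteq> 0" using t I_subset by auto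
  moreover have "energy a b D f < \<infinity>" using f(4) by (auto intro: le_less_trans)
  ultimately have "lambda0 a b D \<le> energy a b D f / (\<integral>\<^sup>+ x. ennreal ((f x)\<^sup>2) \<partial>M)"
    unfolding lambda0_def using f(1,2,3) by (intro Inf_lower) blast
  also have "\<dots> \<le> ennreal (\<phi> y) / (\<integral>\<^sup>+ x. ennreal ((\<phi> (min x t))\<^sup>2) \<partial>M)"
    unfolding divide_ennreal_def
    by (intro mult_mono f(4) ennreal_inverse_antimono nn_integral_mono ennreal_leI power_mono) (auto intro: f(5))
  finally show ?thesis .
qed

text \<open>
  The scale function is continuous, so letting \<open>y\<close> decrease to \<open>t\<close> replaces \<open>\<phi>(y)\<close> by \<open>\<phi>(t)\<close>; the
  denominator does not depend on \<open>y\<close>. If \<open>\<mu>(\<phi>(\<cdot> \<and> t)\<^sup>2)\<close> is infinite, its inverse is \<open>0\<close> and the bound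
  says \<open>\<lambda>\<^sub>0 = 0\<close>.
\<close>
lemma lambda0_le_inverse_delta1': "lambda0 a b D \<le> inverse (delta1' a b D)"
proof -
  have "delta1' a b D \<le> inverse (lambda0 a b D)"
    unfolding delta1'_eq
  proof (rule SUP_least)
    fix t assume t: "t \<in> I"
    then have t': "0 < t" "ereal t < D" by (auto simp: einterval_def)
    obtain z where z: "t < z" "ereal z < D" using ereal_dense2[OF t'(2)] by auto
    have pos: "0 < \<phi> t" by (rule phi_pos[OF t])
    define S where "S = (\<integral>\<^sup>+ x. ennreal ((\<phi> (min x t))\<^sup>2) \<partial>M)"
    have "(\<phi> \<longlongrightarrow> \<phi> t) (at_right t)"
    proof -
      have "(\<phi> \<longlongrightarrow> \<phi> t) (at t)"
        using continuous_on_interior[OF continuous_phi[OF z(2)], of t] t' z by (simp add: isCont_def)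
      then show ?thesis by (rule filterlim_at_split[THEN iffD1, THEN conjunct2])
    qed
    then have lim: "((\<lambda>y. ennreal (\<phi> y) * inverse S) \<longlongrightarrow> ennreal (\<phi> t) * inverse S) (at_right t)"
      if "inverse S \<noteq> \<infinity>"
      using pos that by (intro tendsto_mult_ennreal tendsto_intros) auto
    have "lambda0 a b D \<le> ennreal (\<phi> t) * inverse S"
    proof (cases "inverse S = \<infinity>")
      case True
      then show ?thesis using pos by (simp add: ennreal_mult_top)
    next
      case False
      have "\<forall>\<^sub>F y in at_right t. lambda0 a b D \<le> ennreal (\<phi> y) * inverse S"
        using eventually_at_right_real[OF z(1)]
      proof eventually_elim
        case (elim y)
        then show ?case
          using lambda0_le_truncated[OF t, of y] ereal_less_mono[of y z D] z
          by (simp add: S_def divide_ennreal_def)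
      qed
      then show ?thesis
        using tendsto_lowerbound[OF lim[OF False]] by simp
    qed
    then have "inverse (ennreal (\<phi> t) * inverse S) \<le> inverse (lambda0 a b D)"
      by (rule ennreal_inverse_antimono)
    also have "inverse (ennreal (\<phi> t) * inverse S) = inverse (ennreal (\<phi> t)) * S"
      using pos by (subst ennreal_inverse_mult') auto
    finally show "inverse (ennreal (\<phi> t)) * (\<integral>\<^sup>+ x. ennreal ((\<phi> (min x t))\<^sup>2) \<partial>M) \<le> inverse (lambda0 a b D)"
      by (simp add: S_def)
  qed
  then show ?thesis using ennreal_inverse_antimono by fastforce
qed

end

section \<open>The basic estimates for the mixed eigenvalue\<close>

theorem corollary2:
  fixes a b :: "real \<Rightarrow> real" and D :: ereal
  assumes "0 < D"
    and "a \<in> borel_measurable (restrict_space borel (closed_ivl D))"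
    and "b \<in> borel_measurable (restrict_space borel (closed_ivl D))"
    and "\<And>x. x \<in> einterval 0 D \<Longrightarrow> 0 < a x"
    and "locally_integrable_on (\<lambda>x. b x / a x) (closed_ivl D)"
    and "locally_integrable_on (\<lambda>x. exp (Cfun a b x) / a x) (closed_ivl D)"
  defines "\<phi> \<equiv> phi a b D" and "\<mu> \<equiv> mu a b D"
    and "\<delta> \<equiv> delta a b D" and "\<delta>\<^sub>1 \<equiv> delta1 a b D" and "\<delta>\<^sub>1' \<equiv> delta1' a b D"
  shows "inverse \<delta> \<ge> inverse \<delta>\<^sub>1' \<and> inverse \<delta>\<^sub>1' \<ge> lambda0 a b D \<and>
         lambda0 a b D \<ge> inverse \<delta>\<^sub>1 \<and> inverse \<delta>\<^sub>1 \<ge> inverse (4 * \<delta>) \<and>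
         \<delta>\<^sub>1 = (SUP t\<in>einterval 0 D. inverse (ennreal (sqrt (\<phi> t))) *
                 (\<integral>\<^sup>+ y. ennreal (\<phi> (min t y) * sqrt (\<phi> y)) \<partial>\<mu>)) \<and>
         \<delta>\<^sub>1 = (SUP t\<in>einterval 0 D.
                 inverse (ennreal (sqrt (\<phi> t))) *
                   (\<integral>\<^sup>+ y\<in>einterval 0 t. ennreal (\<phi> y powr (3/2)) \<partial>\<mu>) +
                 ennreal (sqrt (\<phi> t)) * (\<integral>\<^sup>+ y\<in>einterval t D. ennreal (sqrt (\<phi> y)) \<partial>\<mu>)) \<and>
         \<delta>\<^sub>1' = (SUP t\<in>einterval 0 D. inverse (ennreal (\<phi> t)) *
                 (\<integral>\<^sup>+ y. ennreal ((\<phi> (min y t))\<^sup>2) \<partial>\<mu>)) \<and>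
         \<delta> \<le> \<delta>\<^sub>1' \<and> \<delta>\<^sub>1' \<le> 2 * \<delta>"
proof -
  interpret diffusion a b D
    using assms(2,4,5) by unfold_locales
  show ?thesis
    unfolding assms(7-11)
    using ennreal_inverse_antimono[OF delta_le_delta1'] lambda0_le_inverse_delta1'
      inverse_delta1_le_lambda0 ennreal_inverse_antimono[OF delta1_le_delta]
      delta1_eq delta1_eq_split delta1'_eq delta_le_delta1' delta1'_le_delta
    by blast
qed

end
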